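(* Let $m\in\mathbb{N}$, let $K\in\mathrm{M}_m(\mathbb{Z})$ be the companion matrix of a monic polynomial of degree $m$ over $\mathbb{Z}$, and let $L$ be the associated $\mathbb{Z}$-Lie lattice. The affine group scheme $\mathbf{G}_0$ of automorphisms of $L$ fixing its centre pointwise splits as follows: for every integral domain $k$ of characteristic $0$, $$\mathbf{G}_0(k)\cong\mathrm{SL}_2(k[K])\ltimes\mathsf{V}_{\mathrm{st}}(k[K])^{\oplus2},$$ where $\mathsf{V}_{\mathrm{st}}(\cdot)$ denotes the standard left $\mathrm{SL}_2(\cdot)$-module.
   Context: For a monic polynomial $t^m-a_1t^{m-1}-\dots-a_{m-1}t-a_m\in\mathbb{Z}[t]$, the companion matrix $K\in\mathrm{M}_m(\mathbb{Z})$ has entries $K_{i,i+1}=1$ for $1\le i<m$, last row $(a_m,a_{m-1},\dots,a_1)$ and all other entries $0$. The associated $\mathbb{Z}$-Lie lattice $L$ is the free $\mathbb{Z}$-module with ordered basis $\mathcal{S}=(x_1,\dots,x_m,y_1,\dots,y_m,z_1,z_2)$ and Lie bracket $[x_i,y_j]=\delta_{i,j}z_1+K_{ij}z_2$, $[x_i,x_j]=[y_i,y_j]=0$ for $1\le i,j\le m$, with $z_1,z_2$ central; its centre is $Z=\mathbb{Z}z_1+\mathbb{Z}z_2$. For an integral domain $k$ of characteristic $0$, $\mathbf{G}(k)=\mathrm{Aut}(k\otimes_{\mathbb{Z}}L)\le\mathrm{GL}_{2m+2}(k)$ with respect to $\mathcal{S}$ (row vectors, matrices acting from the right), and $\mathbf{G}_0(k)$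 is the kernel of the restriction homomorphism $\mathbf{G}(k)\to\mathrm{GL}(k\otimes_{\mathbb{Z}}Z)$. $k[K]\subseteq\mathrm{M}_m(k)$ is the commutative subalgebra generated by $K$. *)

theory Defs
  imports "Jordan_Normal_Form.Matrix" "HOL-Computational_Algebra.Polynomial"
begin

section \<open>The Lie lattice of a companion matrix\<close>

text \<open>
  All indices are shifted to start at 0. For the polynomial \<open>t^m - a_1 t^(m-1) - \<dots> - a_m\<close>
  one has \<open>coeff p j = - a_(m-j)\<close>, so the last row of the matrix below is \<open>(a_m, \<dots>, a_1)\<close>.
\<close>

definition companion_mat :: "int poly \<Rightarrow> int mat" where
  "companion_mat p = mat (degree p) (degree p)
     (\<lambda>(i, j). if Suc i = degree p then - coeff p j else if j = Suc i then 1 else 0)"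

text \<open>
  The ordered basis \<open>(x_1, \<dots>, x_m, y_1, \<dots>, y_m, z_1, z_2)\<close> is indexed by \<open>0, \<dots>, 2m+1\<close>, so
  \<open>z_1\<close> and \<open>z_2\<close> have indices \<open>2m\<close> and \<open>2m+1\<close>.
  \<open>lie_const m K i j\<close> is the coordinate vector of the bracket of the \<open>i\<close>-th and \<open>j\<close>-th basis elements.
\<close>

definition z_vec :: "nat \<Rightarrow> 'a::comm_ring_1 \<Rightarrow> 'a \<Rightarrow> 'a vec" where
  "z_vec m c d = c \<cdot>\<^sub>v unit_vec (2*m+2) (2*m) + d \<cdot>\<^sub>v unit_vec (2*m+2) (2*m+1)"

definition lie_const :: "nat \<Rightarrow> int mat \<Rightarrow> nat \<Rightarrow> nat \<Rightarrow> int vec" where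
  "lie_const m K i j =
     (if i < m \<and> m \<le> j \<and> j < 2*m then z_vec m (of_bool (i = j - m)) (K $$ (i, j - m))
      else if j < m \<and> m \<le> i \<and> i < 2*m then - z_vec m (of_bool (j = i - m)) (K $$ (j, i - m))
      else 0\<^sub>v (2*m+2))"

text \<open>
  The bracket on \<open>k \<otimes> L\<close>, identified with \<open>k^(2m+2)\<close> (row vectors) by means of the basis. The lattice
  \<open>L\<close> itself is the instance \<open>k = int\<close>.
\<close>

definition lie_bracket :: "nat \<Rightarrow> int mat \<Rightarrow> 'a::comm_ring_1 vec \<Rightarrow> 'a vec \<Rightarrow> 'a vec" where
  "lie_bracket m K u v = vec (2*m+2)
     (\<lambda>l. \<Sum>i<2*m+2. \<Sum>j<2*m+2. u $ i * v $ j * of_int (lie_const m K i j $ l))"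

definition centre_span :: "nat \<Rightarrow> 'a::comm_ring_1 vec set" where
  "centre_span m = {z_vec m c d | c d. True}"

lemma z_vec_index:
  "dim_vec (z_vec m c d) = 2*m+2"
  "l < 2*m+2 \<Longrightarrow> z_vec m c d $ l = (if l = 2*m then c else if l = 2*m+1 then d else 0)"
  by (auto simp: z_vec_def)

lemma lie_const_z:
  assumes "l < 2*m+2" "i \<ge> 2*m \<or> j \<ge> 2*m"
  shows "lie_const m K i j $ l = 0"
  using assms by (auto simp: lie_const_def)

text \<open>
  \<open>centre_span\<close> is the centre, in the lattice \<open>L\<close> as well as in its scalar extensions.
\<close>

lemma centre_span_eq_centre:
  "(centre_span m :: 'a::comm_ring_1 vec set) =
     {v \<in> carrier_vec (2*m+2). \<forall>u \<in> carrier_vec (2*m+2). lie_bracket m K u v = 0\<^sub>v (2*m+2)}"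
  (is "_ = ?C")
proof (intro equalityI subsetI)
  fix v :: "'a vec" assume "v \<in> centre_span m"
  then obtain c d where v: "v = z_vec m c d" by (auto simp: centre_span_def)
  have "lie_bracket m K u v = 0\<^sub>v (2*m+2)" for u
  proof (rule eq_vecI)
    fix l assume "l < dim_vec (0\<^sub>v (2*m+2) :: 'a vec)"
    hence l: "l < 2*m+2" by simp
    have "u $ i * v $ j * of_int (lie_const m K i j $ l) = 0" if "j < 2*m+2" for i j
      using that lie_const_z[OF l, of i j K] z_vec_index(2)[of j m c d]
      by (cases "j < 2*m") (auto simp: v)
    thus "lie_bracket m K u v $ l = (0\<^sub>v (2*m+2) :: 'a vec) $ l"
      using l by (simp add: lie_bracket_def)
  qed (simp add: lie_bracket_def)
  thus "v \<in> ?C" by (auto simp: v z_vec_index intro: carrier_vecI)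
next
  fix v :: "'a vec" assume "v \<in> ?C"
  hence dv: "dim_vec v = 2*m+2"
    and z: "\<And>u. u \<in> carrier_vec (2*m+2) \<Longrightarrow> lie_bracket m K u v = 0\<^sub>v (2*m+2)" by auto
  have br: "(\<Sum>j<2*m+2. v $ j * of_int (lie_const m K i j $ (2*m))) = 0" if i: "i < 2*m" for i
  proof -
    have "0 = lie_bracket m K (unit_vec (2*m+2) i) v $ (2*m)"
      using z[of "unit_vec (2*m+2) i"] by simp
    also have "\<dots> = (\<Sum>i'<2*m+2. \<Sum>j<2*m+2.
        (if i' = i then v $ j * of_int (lie_const m K i j $ (2*m)) else 0))"
      using i by (simp add: lie_bracket_def) (intro sum.cong; auto)
    also have "\<dots> = (\<Sum>i'<2*m+2. if i' = i then
        (\<Sum>j<2*m+2. v $ j * of_int (lie_const m K i j $ (2*m))) else 0)"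
      by (intro sum.cong) auto
    also have "\<dots> = (\<Sum>j<2*m+2. v $ j * of_int (lie_const m K i j $ (2*m)))"
      using i by (subst sum.delta) auto
    finally show ?thesis by simp
  qed
  have v0: "v $ l = 0" if l: "l < 2*m" for l
  proof (cases "l < m")
    case True
    have "(\<Sum>j<2*m+2. v $ j * of_int (lie_const m K (l+m) j $ (2*m)))
        = (\<Sum>j<2*m+2. if j = l then - (v $ l) else 0)"
      using True by (intro sum.cong) (auto simp: lie_const_def z_vec_index)
    with br[of "l+m"] True show ?thesis by (simp add: sum.delta)
  next
    case False
    have "(\<Sum>j<2*m+2. v $ j * of_int (lie_const m K (l-m) j $ (2*m)))
        = (\<Sum>j<2*m+2. if j = l then v $ l else 0)"
      using False l by (intro sum.cong) (auto simp: lie_const_def z_vec_index)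
    with br[of "l-m"] False l show ?thesis by (simp add: sum.delta)
  qed
  have "v = z_vec m (v $ (2*m)) (v $ (2*m+1))"
    by (rule eq_vecI) (auto simp: z_vec_index dv v0)
  thus "v \<in> centre_span m" by (auto simp: centre_span_def)
qed

section \<open>The automorphism groups\<close>

text \<open>Image of the row vector \<open>u\<close> under the right action of the matrix \<open>g\<close>.\<close>

definition row_act :: "'a::comm_ring_1 vec \<Rightarrow> 'a mat \<Rightarrow> 'a vec" where
  "row_act u g = transpose_mat g *\<^sub>v u"

definition GL :: "nat \<Rightarrow> 'a::comm_ring_1 mat monoid" where
  "GL n = units_of (ring_mat TYPE('a) n ())"

definition lie_aut_group :: "nat \<Rightarrow> int mat \<Rightarrow> 'a::comm_ring_1 mat monoid" where
  "lie_aut_group m K = (GL (2*m+2)) \<lparr>carrier :=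
     {g \<in> carrier (GL (2*m+2)). \<forall>u \<in> carrier_vec (2*m+2). \<forall>v \<in> carrier_vec (2*m+2).
        row_act (lie_bracket m K u v) g = lie_bracket m K (row_act u g) (row_act v g)}\<rparr>"

definition lie_aut_group_0 :: "nat \<Rightarrow> int mat \<Rightarrow> 'a::comm_ring_1 mat monoid" where
  "lie_aut_group_0 m K = (lie_aut_group m K) \<lparr>carrier :=
     {g \<in> carrier (lie_aut_group m K). \<forall>z \<in> centre_span m. row_act z g = z}\<rparr>"

section \<open>The algebra \<open>k[K]\<close>\<close>

inductive_set generated_subalgebra :: "nat \<Rightarrow> 'a::comm_ring_1 mat \<Rightarrow> 'a mat set"
  for m :: nat and A :: "'a mat" where
  one: "1\<^sub>m m \<in> generated_subalgebra m A"
| gen: "A \<in> generated_subalgebra m A"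
| add: "\<lbrakk>B \<in> generated_subalgebra m A; C \<in> generated_subalgebra m A\<rbrakk>
         \<Longrightarrow> B + C \<in> generated_subalgebra m A"
| mult: "\<lbrakk>B \<in> generated_subalgebra m A; C \<in> generated_subalgebra m A\<rbrakk>
         \<Longrightarrow> B * C \<in> generated_subalgebra m A"
| smult: "B \<in> generated_subalgebra m A \<Longrightarrow> c \<cdot>\<^sub>m B \<in> generated_subalgebra m A"

definition matrix_algebra :: "nat \<Rightarrow> int mat \<Rightarrow> 'a::comm_ring_1 mat ring" where
  "matrix_algebra m K =
     (ring_mat TYPE('a) m ()) \<lparr>carrier := generated_subalgebra m (map_mat of_int K)\<rparr>"

section \<open>\<open>SL_2\<close>, its standard module, and semidirect products\<close>

text \<open>A 2 by 2 matrix is represented by the pair of its rows.\<close>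

definition SL2 :: "('b, 'c) ring_scheme \<Rightarrow> (('b \<times> 'b) \<times> ('b \<times> 'b)) monoid" where
  "SL2 R = \<lparr>carrier = {((a, b), (c, d)) | a b c d.
       a \<in> carrier R \<and> b \<in> carrier R \<and> c \<in> carrier R \<and> d \<in> carrier R \<and>
       a \<otimes>\<^bsub>R\<^esub> d \<ominus>\<^bsub>R\<^esub> b \<otimes>\<^bsub>R\<^esub> c = \<one>\<^bsub>R\<^esub>},
     mult = (\<lambda>((a, b), (c, d)) ((a', b'), (c', d')).
       ((a \<otimes>\<^bsub>R\<^esub> a' \<oplus>\<^bsub>R\<^esub> b \<otimes>\<^bsub>R\<^esub> c', a \<otimes>\<^bsub>R\<^esub> b' \<oplus>\<^bsub>R\<^esub> b \<otimes>\<^bsub>R\<^esub> d'),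
        (c \<otimes>\<^bsub>R\<^esub> a' \<oplus>\<^bsub>R\<^esub> d \<otimes>\<^bsub>R\<^esub> c', c \<otimes>\<^bsub>R\<^esub> b' \<oplus>\<^bsub>R\<^esub> d \<otimes>\<^bsub>R\<^esub> d'))),
     one = ((\<one>\<^bsub>R\<^esub>, \<zero>\<^bsub>R\<^esub>), (\<zero>\<^bsub>R\<^esub>, \<one>\<^bsub>R\<^esub>))\<rparr>"

definition V_st :: "('b, 'c) ring_scheme \<Rightarrow> ('b \<times> 'b) monoid" where
  "V_st R = add_monoid R \<times>\<times> add_monoid R"

definition V_st_act :: "('b, 'c) ring_scheme \<Rightarrow> ('b \<times> 'b) \<times> ('b \<times> 'b) \<Rightarrow> 'b \<times> 'b \<Rightarrow> 'b \<times> 'b" where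
  "V_st_act R = (\<lambda>((a, b), (c, d)) (v, w).
     (a \<otimes>\<^bsub>R\<^esub> v \<oplus>\<^bsub>R\<^esub> b \<otimes>\<^bsub>R\<^esub> w, c \<otimes>\<^bsub>R\<^esub> v \<oplus>\<^bsub>R\<^esub> d \<otimes>\<^bsub>R\<^esub> w))"

text \<open>
  The semidirect product for a left action \<open>\<phi>\<close> of \<open>H\<close> on \<open>N\<close>. With the factors in this order, \<open>(h, n)\<close>
  stands for the product \<open>n h\<close>, and \<open>h n = \<phi>(h)(n) h\<close>.
\<close>

definition semidirect ::
    "('h, 'c) monoid_scheme \<Rightarrow> ('n, 'd) monoid_scheme \<Rightarrow> ('h \<Rightarrow> 'n \<Rightarrow> 'n) \<Rightarrow> ('h \<times> 'n) monoid" where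
  "semidirect H N \<phi> = \<lparr>carrier = carrier H \<times> carrier N,
     mult = (\<lambda>(h, n) (h', n'). (h \<otimes>\<^bsub>H\<^esub> h', n \<otimes>\<^bsub>N\<^esub> \<phi> h n')),
     one = (\<one>\<^bsub>H\<^esub>, \<one>\<^bsub>N\<^esub>)\<rparr>"

definition SL2_V_st_V_st ::
    "('b, 'c) ring_scheme \<Rightarrow> ((('b \<times> 'b) \<times> ('b \<times> 'b)) \<times> (('b \<times> 'b) \<times> ('b \<times> 'b))) monoid" where
  "SL2_V_st_V_st R =
     semidirect (SL2 R) (V_st R \<times>\<times> V_st R) (\<lambda>g. map_prod (V_st_act R g) (V_st_act R g))"

end

theory Submission
  imports Defs
begin

text \<open>
  The bracket takes values in the centre, and its two coordinates are the alternating forms on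
  \<open>k^(2m)\<close> with Gram matrices \<open>J = [[0, 1], [-1, 0]]\<close> and \<open>J_K = [[0, K], [-K^T, 0]]\<close>. An automorphism
  that fixes the centre is therefore a matrix \<open>[[M, W], [0, 1]]\<close> in which \<open>W\<close> is arbitrary and \<open>M\<close> is an
  isometry of both forms (\<open>lie_aut_group_0_iff\<close>). It remains to find the common isometries \<open>M\<close> and
  the action of \<open>M\<close> on the columns of \<open>W\<close>.

  Since \<open>J_K = N J\<close> with \<open>N = diag(K, K^T)\<close>, an isometry of \<open>J\<close> is an isometry of \<open>J_K\<close> exactly if it
  commutes with \<open>N\<close>. The blocks of such an \<open>M\<close> intertwine \<open>K\<close> and \<open>K^T\<close> in the four possible ways, and
  two properties of a companion matrix turn them into elements of \<open>k[K]\<close>.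

  \<^item> There is a symmetric invertible \<open>S\<close> with \<open>K S = S K^T\<close>. After conjugation by \<open>diag(1, S)\<close> all four
    blocks commute with \<open>K\<close>.

  \<^item> The last unit column \<open>E\<close> is a cyclic vector: every column is \<open>a E\<close> for some \<open>a\<close> in \<open>k[K]\<close>. A matrix
    that commutes with \<open>K\<close> is determined by its value at \<open>E\<close>, so the centralizer of \<open>K\<close> is \<open>k[K]\<close>
    (\<open>centralizer_eq_Alg\<close>), and \<open>a \<mapsto> a E\<close> identifies \<open>k[K]\<close> with \<open>k^m\<close> as a module.

  Let \<open>[[a, b], [c, d]]\<close> be the conjugated matrix. As \<open>S a^T = a S\<close> for all \<open>a\<close> in the commutative algebra
  \<open>k[K]\<close>, transposition becomes trivial there, and \<open>M J M^T = J\<close> collapses to the single equation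
  \<open>a d - b c = 1\<close>, as for \<open>Sp_2 = SL_2\<close> (\<open>twisted_block_preserves_form_iff\<close>). The isometries thus form
  \<open>SL_2(k[K])\<close>, and each of the two columns of \<open>W\<close>, split into halves and read in \<open>k[K]\<close> by means of \<open>E\<close>,
  is a copy of the standard module.

  For \<open>S\<close> one can take the Hankel matrix of the numbers \<open>(K^n E)_1\<close>; its inverse is the Hankel matrix of
  the coefficients of the polynomial (\<open>hankel_inverse\<close>), hence is defined over every \<open>k\<close>.
\<close>

section \<open>The bracket as a pair of alternating forms\<close>

lemma four_block_mat_eq_iff:
  assumes "A \<in> carrier_mat nr1 nc1" "B \<in> carrier_mat nr1 nc2"
    "C \<in> carrier_mat nr2 nc1" "D \<in> carrier_mat nr2 nc2"
    and "A' \<in> carrier_mat nr1 nc1" "B' \<in> carrier_mat nr1 nc2"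
    "C' \<in> carrier_mat nr2 nc1" "D' \<in> carrier_mat nr2 nc2"
  shows "four_block_mat A B C D = four_block_mat A' B' C' D' \<longleftrightarrow> A = A' \<and> B = B' \<and> C = C' \<and> D = D'"
proof
  assume eq: "four_block_mat A B C D = four_block_mat A' B' C' D'"
  have blk: "split_block (four_block_mat A B C D) nr1 nc1 = (A, B, C, D)"
    if "A \<in> carrier_mat nr1 nc1" "B \<in> carrier_mat nr1 nc2"
      "C \<in> carrier_mat nr2 nc1" "D \<in> carrier_mat nr2 nc2" for A B C D :: "'a mat"
    using that by (auto simp: split_block_def Let_def intro!: eq_matI)
  have "(A, B, C, D) = (A', B', C', D')"
    using blk[OF assms(1-4)] unfolding eq blk[OF assms(5-8)] by (rule sym)
  then show "A = A' \<and> B = B' \<and> C = C' \<and> D = D'" by simp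
qed simp

definition skew_block :: "'a::comm_ring_1 mat \<Rightarrow> 'a mat" where
  "skew_block X = four_block_mat (0\<^sub>m (dim_row X) (dim_row X)) X (- X\<^sup>T) (0\<^sub>m (dim_col X) (dim_col X))"

text \<open>
  The Gram matrix on \<open>k^(2m+2)\<close> of a form on \<open>k^(2m)\<close> that has the centre in its radical.
\<close>

definition centre_extended :: "'a::comm_ring_1 mat \<Rightarrow> 'a mat" where
  "centre_extended F = four_block_mat F (0\<^sub>m (dim_row F) 2) (0\<^sub>m 2 (dim_col F)) (0\<^sub>m 2 2)"

lemma skew_block_carrier [simp]: "X \<in> carrier_mat m m \<Longrightarrow> skew_block X \<in> carrier_mat (2*m) (2*m)"
  unfolding skew_block_def mult_2 by auto

lemma centre_extended_carrier [simp]: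
  "F \<in> carrier_mat n n \<Longrightarrow> centre_extended F \<in> carrier_mat (n+2) (n+2)"
  by (auto simp: centre_extended_def)

lemma bilinear_form_sum:
  fixes F :: "'a::comm_ring_1 mat"
  assumes "F \<in> carrier_mat n n" "u \<in> carrier_vec n" "v \<in> carrier_vec n"
  shows "u \<bullet> (F *\<^sub>v v) = (\<Sum>i<n. \<Sum>j<n. u $ i * v $ j * F $$ (i, j))"
proof -
  have "dim_vec u = n" "dim_vec v = n" "dim_row F = n" "dim_col F = n" using assms by auto
  then show ?thesis
    unfolding lessThan_atLeast0 scalar_prod_def
    by (simp add: scalar_prod_def sum_distrib_left) (intro sum.cong refl, simp add: mult.assoc)
qed

lemma lie_const_forms:
  assumes K: "K \<in> carrier_mat m m" and ij: "i < 2*m+2" "j < 2*m+2"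
  shows "l < 2*m \<Longrightarrow> lie_const m K i j $ l = 0"
    and "(of_int (lie_const m K i j $ (2*m)) :: 'a::comm_ring_1) = centre_extended (skew_block (1\<^sub>m m)) $$ (i, j)"
    and "(of_int (lie_const m K i j $ Suc (2*m)) :: 'a) = centre_extended (skew_block (map_mat of_int K)) $$ (i, j)"
proof -
  have d: "dim_row K = m" "dim_col K = m" using K by auto
  show "l < 2*m \<Longrightarrow> lie_const m K i j $ l = 0"
    by (auto simp: lie_const_def z_vec_index)
  show "(of_int (lie_const m K i j $ (2*m)) :: 'a) = centre_extended (skew_block (1\<^sub>m m)) $$ (i, j)"
    using ij by (auto simp: lie_const_def z_vec_index centre_extended_def skew_block_def)
  show "(of_int (lie_const m K i j $ Suc (2*m)) :: 'a) = centre_extended (skew_block (map_mat of_int K)) $$ (i, j)"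
    using ij d by (auto simp: lie_const_def z_vec_index centre_extended_def skew_block_def)
qed

lemma lie_bracket_eq_forms:
  fixes u v :: "'a::comm_ring_1 vec"
  assumes K: "K \<in> carrier_mat m m" and u: "u \<in> carrier_vec (2*m+2)" and v: "v \<in> carrier_vec (2*m+2)"
  shows "lie_bracket m K u v = z_vec m (u \<bullet> (centre_extended (skew_block (1\<^sub>m m)) *\<^sub>v v))
      (u \<bullet> (centre_extended (skew_block (map_mat of_int K)) *\<^sub>v v))" (is "_ = z_vec m (_ \<bullet> (?F1 *\<^sub>v _)) (_ \<bullet> (?FK *\<^sub>v _))")
proof (rule eq_vecI)
  fix l assume "l < dim_vec (z_vec m (u \<bullet> (?F1 *\<^sub>v v)) (u \<bullet> (?FK *\<^sub>v v)))"
  then have l: "l < 2*m+2" by (simp add: z_vec_index)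
  have F: "?F1 \<in> carrier_mat (2*m+2) (2*m+2)" "?FK \<in> carrier_mat (2*m+2) (2*m+2)"
    using K by (intro centre_extended_carrier skew_block_carrier; simp)+
  have br: "lie_bracket m K u v $ l = (\<Sum>i<2*m+2. \<Sum>j<2*m+2. u $ i * v $ j * of_int (lie_const m K i j $ l))"
    unfolding lie_bracket_def by (rule index_vec[OF l])
  consider "l < 2*m" | "l = 2*m" | "l = Suc (2*m)" using l by linarith
  then show "lie_bracket m K u v $ l = z_vec m (u \<bullet> (?F1 *\<^sub>v v)) (u \<bullet> (?FK *\<^sub>v v)) $ l"
  proof cases
    case 1
    have "lie_bracket m K u v $ l = 0"
      unfolding br using 1 by (intro sum.neutral ballI) (simp add: lie_const_forms(1)[OF K])
    with 1 show ?thesis by (simp add: z_vec_index)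
  next
    case 2
    have "lie_bracket m K u v $ l = u \<bullet> (?F1 *\<^sub>v v)"
      unfolding br bilinear_form_sum[OF F(1) u v]
      by (intro sum.cong refl) (simp add: 2 lie_const_forms(2)[OF K])
    with 2 show ?thesis by (simp add: z_vec_index)
  next
    case 3
    have "lie_bracket m K u v $ l = u \<bullet> (?FK *\<^sub>v v)"
      unfolding br bilinear_form_sum[OF F(2) u v]
      by (intro sum.cong refl) (simp add: 3 lie_const_forms(3)[OF K])
    with 3 show ?thesis by (simp add: z_vec_index)
  qed
qed (simp_all add: lie_bracket_def z_vec_index)

lemma z_vec_eq_iff: "z_vec m c d = z_vec m c' d' \<longleftrightarrow> c = c' \<and> d = d'"
proof
  assume eq: "z_vec m c d = z_vec m c' d'"
  have "z_vec m c d $ (2*m) = z_vec m c' d' $ (2*m)" "z_vec m c d $ (2*m+1) = z_vec m c' d' $ (2*m+1)"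
    unfolding eq by simp_all
  then show "c = c' \<and> d = d'" by (simp_all add: z_vec_index del: One_nat_def)
qed simp

text \<open>
  Row vectors are multiplied from the right, so a form with Gram matrix \<open>F\<close> pulls back to \<open>g F g^T\<close>.
\<close>

lemma congruence_iff_preserves_form:
  fixes F g :: "'a::comm_ring_1 mat"
  assumes F: "F \<in> carrier_mat n n" and g: "g \<in> carrier_mat n n"
  shows "g * F * g\<^sup>T = F \<longleftrightarrow> (\<forall>u\<in>carrier_vec n. \<forall>v\<in>carrier_vec n.
           row_act u g \<bullet> (F *\<^sub>v row_act v g) = u \<bullet> (F *\<^sub>v v))"
proof -
  have pull: "row_act u g \<bullet> (F *\<^sub>v row_act v g) = u \<bullet> (g * F * g\<^sup>T *\<^sub>v v)"
    if u: "u \<in> carrier_vec n" and v: "v \<in> carrier_vec n" for u v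
  proof -
    have "row_act u g \<bullet> (F *\<^sub>v row_act v g) = u \<bullet> (g *\<^sub>v (F *\<^sub>v (g\<^sup>T *\<^sub>v v)))"
      unfolding row_act_def using F g u v by (intro transpose_vec_mult_scalar) auto
    also have "g *\<^sub>v (F *\<^sub>v (g\<^sup>T *\<^sub>v v)) = g * F * g\<^sup>T *\<^sub>v v"
      using F g v by (simp add: assoc_mult_mat_vec[of _ n n _ n])
    finally show ?thesis .
  qed
  show ?thesis
  proof
    assume "g * F * g\<^sup>T = F"
    with pull show "\<forall>u\<in>carrier_vec n. \<forall>v\<in>carrier_vec n.
           row_act u g \<bullet> (F *\<^sub>v row_act v g) = u \<bullet> (F *\<^sub>v v)" by simp
  next
    assume *: "\<forall>u\<in>carrier_vec n. \<forall>v\<in>carrier_vec n.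
           row_act u g \<bullet> (F *\<^sub>v row_act v g) = u \<bullet> (F *\<^sub>v v)"
    have entry: "unit_vec n i \<bullet> (G *\<^sub>v unit_vec n j) = G $$ (i, j)"
      if "G \<in> carrier_mat n n" "i < n" "j < n" for i j and G :: "'a mat"
      using that by auto
    show "g * F * g\<^sup>T = F"
    proof (rule eq_matI)
      fix i j assume "i < dim_row F" "j < dim_col F"
      then have ij: "i < n" "j < n" using F by auto
      have "(g * F * g\<^sup>T) $$ (i, j) = unit_vec n i \<bullet> (g * F * g\<^sup>T *\<^sub>v unit_vec n j)"
        using F g ij by (subst entry) auto
      also have "\<dots> = unit_vec n i \<bullet> (F *\<^sub>v unit_vec n j)"
        using * by (simp add: pull)
      also have "\<dots> = F $$ (i, j)" using F ij by (rule entry)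
      finally show "(g * F * g\<^sup>T) $$ (i, j) = F $$ (i, j)" .
    qed (use F g in auto)
  qed
qed

lemma congruence_centre_extended:
  fixes M :: "'a::comm_ring_1 mat"
  assumes M: "M \<in> carrier_mat n n" and W: "W \<in> carrier_mat n 2" and F: "F \<in> carrier_mat n n"
    and g: "g = four_block_mat M W (0\<^sub>m 2 n) (1\<^sub>m 2)"
  shows "g * centre_extended F * g\<^sup>T = centre_extended F \<longleftrightarrow> M * F * M\<^sup>T = F"
proof -
  have d: "dim_row F = n" "dim_col F = n" using F by auto
  have gT: "g\<^sup>T = four_block_mat M\<^sup>T (0\<^sub>m n 2) W\<^sup>T (1\<^sub>m 2)"
    unfolding g by (subst transpose_four_block_mat[OF M W]) auto
  have "g * centre_extended F = four_block_mat (M * F) (0\<^sub>m n 2) (0\<^sub>m 2 n) (0\<^sub>m 2 2)"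
    unfolding g centre_extended_def d
    using M W F by (subst mult_four_block_mat[of _ n n _ 2 _ 2 _ _ n _ 2]) auto
  also have "\<dots> * g\<^sup>T = four_block_mat (M * F * M\<^sup>T) (0\<^sub>m n 2) (0\<^sub>m 2 n) (0\<^sub>m 2 2)"
    unfolding gT using M W F by (subst mult_four_block_mat[of _ n n _ 2 _ 2 _ _ n _ 2]) auto
  finally have gFg: "g * centre_extended F * g\<^sup>T = four_block_mat (M * F * M\<^sup>T) (0\<^sub>m n 2) (0\<^sub>m 2 n) (0\<^sub>m 2 2)" .
  show ?thesis
    unfolding gFg unfolding centre_extended_def d using M F
    by (subst four_block_mat_eq_iff[of _ n n _ 2 _ 2]) auto
qed

section \<open>Automorphisms that fix the centre\<close>

text \<open>
  Fixing the centre pointwise means that the last two rows of \<open>g\<close> are unit vectors. The subspace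
  spanned by the \<open>x_i\<close> and \<open>y_i\<close> need not be stable, whence the free block \<open>W\<close>.
\<close>

lemma fixes_centre_iff:
  fixes g :: "'a::comm_ring_1 mat"
  assumes g: "g \<in> carrier_mat (2*m+2) (2*m+2)"
  shows "(\<forall>z\<in>centre_span m. row_act z g = z) \<longleftrightarrow>
    (\<exists>M\<in>carrier_mat (2*m) (2*m). \<exists>W\<in>carrier_mat (2*m) 2. g = four_block_mat M W (0\<^sub>m 2 (2*m)) (1\<^sub>m 2))"
proof
  assume fix_z: "\<forall>z\<in>centre_span m. row_act z g = z"
  obtain M W C D where s: "split_block g (2*m) (2*m) = (M, W, C, D)" by (metis prod_cases4)
  have dg: "dim_row g = 2*m + 2" "dim_col g = 2*m+2" using g by auto
  note blk = split_block[OF s dg]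
  have row: "row g i = unit_vec (2*m+2) i" if i: "i = 2*m \<or> i = 2*m+1" for i
  proof -
    have "(unit_vec (2*m+2) i :: 'a vec) = z_vec m (of_bool (i = 2*m)) (of_bool (i = 2*m+1))"
      using i by (intro eq_vecI) (auto simp: z_vec_index)
    then have "unit_vec (2*m+2) i \<in> (centre_span m :: 'a vec set)" unfolding centre_span_def by blast
    with fix_z have "row_act (unit_vec (2*m+2) i) g = unit_vec (2*m+2) i" by blast
    moreover have "row_act (unit_vec (2*m+2) i) g = row g i"
      using g i by (auto simp: row_act_def intro!: eq_vecI)
    ultimately show ?thesis by simp
  qed
  have low: "g $$ (i, j) = of_bool (i = j)" if "2*m \<le> i" "i < 2*m+2" "j < 2*m+2" for i j
  proof -
    have "g $$ (i, j) = row g i $ j" using g that by simp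
    also have "\<dots> = of_bool (i = j)" using that by (subst row) auto
    finally show ?thesis .
  qed
  have "C = 0\<^sub>m 2 (2*m)" "D = 1\<^sub>m 2"
    using s dg by (auto simp: split_block_def Let_def low intro!: eq_matI)
  with blk show "\<exists>M\<in>carrier_mat (2*m) (2*m). \<exists>W\<in>carrier_mat (2*m) 2. g = four_block_mat M W (0\<^sub>m 2 (2*m)) (1\<^sub>m 2)"
    by blast
next
  assume "\<exists>M\<in>carrier_mat (2*m) (2*m). \<exists>W\<in>carrier_mat (2*m) 2. g = four_block_mat M W (0\<^sub>m 2 (2*m)) (1\<^sub>m 2)"
  then obtain M W where MW: "M \<in> carrier_mat (2*m) (2*m)" "W \<in> carrier_mat (2*m) 2"
    and g': "g = four_block_mat M W (0\<^sub>m 2 (2*m)) (1\<^sub>m 2)" by blast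
  have row: "row_act (unit_vec (2*m+2) i) g = unit_vec (2*m+2) i" if "i = 2*m \<or> i = 2*m+1" for i
  proof -
    have "row_act (unit_vec (2*m+2) i) g = row g i"
      using g that by (auto simp: row_act_def intro!: eq_vecI)
    also have "\<dots> = unit_vec (2*m+2) i"
      using that MW by (auto simp: g' intro!: eq_vecI)
    finally show ?thesis .
  qed
  have gT: "g\<^sup>T \<in> carrier_mat (2*m+2) (2*m+2)" using g by simp
  have scale: "g\<^sup>T *\<^sub>v (k \<cdot>\<^sub>v unit_vec (2*m+2) i) = k \<cdot>\<^sub>v (g\<^sup>T *\<^sub>v unit_vec (2*m+2) i)" for k i
  proof (rule eq_vecI)
    fix j assume "j < dim_vec (k \<cdot>\<^sub>v (g\<^sup>T *\<^sub>v unit_vec (2*m+2) i))"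
    then have "j < dim_row g\<^sup>T" "row g\<^sup>T j \<in> carrier_vec (2*m+2)" using gT by auto
    then show "(g\<^sup>T *\<^sub>v (k \<cdot>\<^sub>v unit_vec (2*m+2) i)) $ j = (k \<cdot>\<^sub>v (g\<^sup>T *\<^sub>v unit_vec (2*m+2) i)) $ j"
      using scalar_prod_smult_distrib[of "row g\<^sup>T j" "2*m+2" "unit_vec (2*m+2) i" k] unit_vec_carrier
      by simp
  qed simp
  show "\<forall>z\<in>centre_span m. row_act z g = z"
  proof
    fix z :: "'a vec" assume "z \<in> centre_span m"
    then obtain c d where z: "z = z_vec m c d" by (auto simp: centre_span_def)
    have "row_act z g = c \<cdot>\<^sub>v row_act (unit_vec (2*m+2) (2*m)) g + d \<cdot>\<^sub>v row_act (unit_vec (2*m+2) (2*m+1)) g"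
      unfolding z z_vec_def row_act_def
      by (simp only: mult_add_distrib_mat_vec[OF gT] scale unit_vec_carrier smult_carrier_vec)
    also have "\<dots> = z" by (simp only: row simp_thms z z_vec_def)
    finally show "row_act z g = z" .
  qed
qed

lemma GL_carrier_iff:
  "g \<in> carrier (GL n) \<longleftrightarrow> g \<in> carrier_mat n n \<and> (\<exists>h\<in>carrier_mat n n. h * g = 1\<^sub>m n \<and> g * h = 1\<^sub>m n)"
  unfolding GL_def units_of_def Units_def ring_mat_simps by auto

lemma unitriangular_invertible_iff:
  fixes M :: "'a::comm_ring_1 mat"
  assumes M: "M \<in> carrier_mat n n" and W: "W \<in> carrier_mat n r"
  shows "four_block_mat M W (0\<^sub>m r n) (1\<^sub>m r) \<in> carrier (GL (n+r)) \<longleftrightarrow> M \<in> carrier (GL n)"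
    (is "?g \<in> _ \<longleftrightarrow> _")
proof
  assume "?g \<in> carrier (GL (n+r))"
  then obtain h where h: "h \<in> carrier_mat (n+r) (n+r)" "h * ?g = 1\<^sub>m (n+r)" "?g * h = 1\<^sub>m (n+r)"
    unfolding GL_carrier_iff by blast
  obtain P Q R V where s: "split_block h n n = (P, Q, R, V)" by (metis prod_cases4)
  note blk = split_block[OF s, of r r]
  have c: "P \<in> carrier_mat n n" "Q \<in> carrier_mat n r" "R \<in> carrier_mat r n" "V \<in> carrier_mat r r"
    and hb: "h = four_block_mat P Q R V" using blk h(1) by auto
  have "h * ?g = four_block_mat (P * M) (P * W + Q) (R * M) (R * W + V)"
    unfolding hb using c M W by (subst mult_four_block_mat[of _ n n _ r _ r _ _ n _ r]) auto
  then have "four_block_mat (P * M) (P * W + Q) (R * M) (R * W + V) =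
      four_block_mat (1\<^sub>m n) (0\<^sub>m n r) (0\<^sub>m r n) (1\<^sub>m r)" using h(2) by simp
  then have "P * M = 1\<^sub>m n"
    by (subst (asm) four_block_mat_eq_iff[of _ n n _ r _ r]) (use c M W in auto)
  moreover have "?g * h = four_block_mat (M * P + W * R) (M * Q + W * V) R V"
    unfolding hb using c M W by (subst mult_four_block_mat[of _ n n _ r _ r _ _ n _ r]) auto
  then have "four_block_mat (M * P + W * R) (M * Q + W * V) R V =
      four_block_mat (1\<^sub>m n) (0\<^sub>m n r) (0\<^sub>m r n) (1\<^sub>m r)" using h(3) by simp
  then have "M * P + W * R = 1\<^sub>m n \<and> R = 0\<^sub>m r n"
    by (subst (asm) four_block_mat_eq_iff[of _ n n _ r _ r]) (use c M W in auto)
  then have "M * P = 1\<^sub>m n" using M W c by auto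
  ultimately show "M \<in> carrier (GL n)" using M c by (auto simp: GL_carrier_iff)
next
  assume "M \<in> carrier (GL n)"
  then obtain P where P: "P \<in> carrier_mat n n" "P * M = 1\<^sub>m n" "M * P = 1\<^sub>m n"
    unfolding GL_carrier_iff by blast
  let ?h = "four_block_mat P (- (P * W)) (0\<^sub>m r n) (1\<^sub>m r)"
  have MPW: "M * (P * W) = W"
    using assoc_mult_mat[OF M P(1) W] P W by simp
  have zero: "- 0\<^sub>m r r + 1\<^sub>m r = (1\<^sub>m r :: 'a mat)" by (intro eq_matI) auto
  have cancel': "- W + W = 0\<^sub>m n r" using W by (intro eq_matI) auto
  have cancel: "P * W + - (P * W) = 0\<^sub>m n r" using P W by (intro eq_matI) auto
  have "?h * ?g = four_block_mat (1\<^sub>m n) (0\<^sub>m n r) (0\<^sub>m r n) (1\<^sub>m r)"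
    using P M W by (subst mult_four_block_mat[of _ n n _ r _ r _ _ n _ r]) (auto simp: cancel)
  moreover have "?g * ?h = four_block_mat (1\<^sub>m n) (0\<^sub>m n r) (0\<^sub>m r n) (1\<^sub>m r)"
    using P M W by (subst mult_four_block_mat[of _ n n _ r _ r _ _ n _ r])
      (auto simp: MPW cancel' zero)
  ultimately show "?g \<in> carrier (GL (n+r))"
    using P(1) M W by (auto simp: GL_carrier_iff intro!: bexI[of _ ?h])
qed

text \<open>
  A bracket is central, hence fixed by \<open>g\<close>; compatibility with the bracket is therefore invariance of
  the two coordinate forms.
\<close>

lemma lie_aut_group_0_iff:
  fixes g :: "'a::comm_ring_1 mat"
  assumes K: "K \<in> carrier_mat m m"
  shows "g \<in> carrier (lie_aut_group_0 m K) \<longleftrightarrow>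
    (\<exists>M W. g = four_block_mat M W (0\<^sub>m 2 (2*m)) (1\<^sub>m 2) \<and> W \<in> carrier_mat (2*m) 2 \<and>
       M \<in> carrier (GL (2*m)) \<and>
       M * skew_block (1\<^sub>m m) * M\<^sup>T = skew_block (1\<^sub>m m) \<and>
       M * skew_block (map_mat of_int K) * M\<^sup>T = skew_block (map_mat of_int K))"
    (is "_ \<longleftrightarrow> (\<exists>M W. ?R M W)")
proof -
  let ?F1 = "centre_extended (skew_block (1\<^sub>m m)) :: 'a mat"
  let ?FK = "centre_extended (skew_block (map_mat of_int K)) :: 'a mat"
  have F: "?F1 \<in> carrier_mat (2*m+2) (2*m+2)" "?FK \<in> carrier_mat (2*m+2) (2*m+2)"
    using K by (intro centre_extended_carrier skew_block_carrier; simp)+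
  have sk: "skew_block (1\<^sub>m m) \<in> carrier_mat (2*m) (2*m)"
    "skew_block (map_mat of_int K :: 'a mat) \<in> carrier_mat (2*m) (2*m)" using K by auto
  have main: "?thesis" if g: "g \<in> carrier_mat (2*m+2) (2*m+2)"
    and fix_z: "\<forall>z\<in>centre_span m. row_act z g = z"
  proof -
    have act: "row_act u g \<in> carrier_vec (2*m+2)" if "u \<in> carrier_vec (2*m+2)" for u
      using g that by (auto simp: row_act_def)
    have "(row_act (lie_bracket m K u v) g = lie_bracket m K (row_act u g) (row_act v g)) \<longleftrightarrow>
        row_act u g \<bullet> (?F1 *\<^sub>v row_act v g) = u \<bullet> (?F1 *\<^sub>v v) \<and>
        row_act u g \<bullet> (?FK *\<^sub>v row_act v g) = u \<bullet> (?FK *\<^sub>v v)"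
      if u: "u \<in> carrier_vec (2*m+2)" and v: "v \<in> carrier_vec (2*m+2)" for u v
    proof -
      have "lie_bracket m K u v \<in> centre_span m"
        unfolding lie_bracket_eq_forms[OF K u v] centre_span_def by blast
      then have fixed: "row_act (lie_bracket m K u v) g = lie_bracket m K u v" using fix_z by blast
      show ?thesis
        unfolding fixed unfolding lie_bracket_eq_forms[OF K u v]
          lie_bracket_eq_forms[OF K act[OF u] act[OF v]] z_vec_eq_iff by (auto dest: sym)
    qed
    then have pres: "(\<forall>u \<in> carrier_vec (2*m+2). \<forall>v \<in> carrier_vec (2*m+2).
        row_act (lie_bracket m K u v) g = lie_bracket m K (row_act u g) (row_act v g)) \<longleftrightarrow>
        g * ?F1 * g\<^sup>T = ?F1 \<and> g * ?FK * g\<^sup>T = ?FK"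
      unfolding congruence_iff_preserves_form[OF F(1) g] congruence_iff_preserves_form[OF F(2) g]
      by blast
    obtain M W where MW: "M \<in> carrier_mat (2*m) (2*m)" "W \<in> carrier_mat (2*m) 2"
      and gb: "g = four_block_mat M W (0\<^sub>m 2 (2*m)) (1\<^sub>m 2)"
      using fix_z fixes_centre_iff[OF g] by blast
    have "g \<in> carrier (lie_aut_group_0 m K) \<longleftrightarrow> g \<in> carrier (GL (2*m+2)) \<and>
        g * ?F1 * g\<^sup>T = ?F1 \<and> g * ?FK * g\<^sup>T = ?FK"
      unfolding lie_aut_group_0_def lie_aut_group_def using fix_z pres by auto
    also have "\<dots> \<longleftrightarrow> ?R M W"
      unfolding congruence_centre_extended[OF MW sk(1) gb] congruence_centre_extended[OF MW sk(2) gb]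
      using MW(2) unitriangular_invertible_iff[OF MW] gb by blast
    also have "\<dots> \<longleftrightarrow> (\<exists>M W. ?R M W)"
    proof
      assume "\<exists>M W. ?R M W"
      then obtain M' W' where R: "?R M' W'" by blast
      then have M': "M' \<in> carrier_mat (2*m) (2*m)" unfolding GL_carrier_iff by blast
      have "four_block_mat M' W' (0\<^sub>m 2 (2*m)) (1\<^sub>m 2) = four_block_mat M W (0\<^sub>m 2 (2*m)) (1\<^sub>m 2)"
        using R gb by blast
      then have "M' = M \<and> W' = W"
        by (subst (asm) four_block_mat_eq_iff[of _ "2*m" "2*m" _ 2 _ 2]) (use R M' MW in auto)
      with R show "?R M W" by simp
    qed blast
    finally show ?thesis .
  qed
  show ?thesis
  proof
    assume "g \<in> carrier (lie_aut_group_0 m K)"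
    moreover from this have "g \<in> carrier_mat (2*m+2) (2*m+2)" "\<forall>z\<in>centre_span m. row_act z g = z"
      unfolding lie_aut_group_0_def lie_aut_group_def by (auto simp: GL_carrier_iff)
    ultimately show "\<exists>M W. ?R M W" using main by blast
  next
    assume R: "\<exists>M W. ?R M W"
    then obtain M W where MW: "?R M W" by blast
    then have M: "M \<in> carrier_mat (2*m) (2*m)" unfolding GL_carrier_iff by blast
    have g: "g \<in> carrier_mat (2*m+2) (2*m+2)"
      using MW M four_block_carrier_mat[of M "2*m" "2*m" "1\<^sub>m 2" 2 2 W "0\<^sub>m 2 (2*m)"] one_carrier_mat[of 2] by metis
    have "\<forall>z\<in>centre_span m. row_act z g = z"
      unfolding fixes_centre_iff[OF g] using MW M by blast
    with g R main show "g \<in> carrier (lie_aut_group_0 m K)" by blast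
  qed
qed

section \<open>Common isometries of the two forms\<close>

text \<open>Columns are \<open>m\<close> by \<open>1\<close> matrices below; this keeps the simplifier from turning their width into \<open>Suc 0\<close>.\<close>

declare One_nat_def [simp del]

lemma uminus_zero_mat [simp]: "- 0\<^sub>m n k = (0\<^sub>m n k :: 'a::group_add mat)"
  by (rule eq_matI) auto

text \<open>
  The determination of the isometries uses only these properties of \<open>A\<close>: it has a cyclic column \<open>E\<close>,
  and it is self-adjoint for the symmetric perfect pairing of row vectors with Gram matrix \<open>S\<close>, whose
  inverse is \<open>T\<close>.
\<close>

locale cyclic_self_adjoint =
  fixes m :: nat and A S T E :: "'a::comm_ring_1 mat"
  assumes A [simp]: "A \<in> carrier_mat m m" and S [simp]: "S \<in> carrier_mat m m"
    and T [simp]: "T \<in> carrier_mat m m" and E [simp]: "E \<in> carrier_mat m 1"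
    and S_sym: "S\<^sup>T = S" and T_sym: "T\<^sup>T = T"
    and ST: "S * T = 1\<^sub>m m" and TS: "T * S = 1\<^sub>m m"
    and AS: "A * S = S * A\<^sup>T"
    and cyclic: "\<And>Y. Y \<in> carrier_mat m 1 \<Longrightarrow> \<exists>a\<in>generated_subalgebra m A. Y = a * E"
begin

abbreviation "Alg \<equiv> generated_subalgebra m A"

lemmas dims [simp] = carrier_matD[OF A] carrier_matD[OF S] carrier_matD[OF T] carrier_matD[OF E]

text \<open>
  In the general rules the inner dimension of a product occurs in the premises only, where the
  simplifier does not guess it. The instances fix it to be \<open>m\<close>.
\<close>

lemmas carriers [simp] = mult_carrier_mat[of _ m m _ m] mult_carrier_mat[of _ m m _ 1]

lemmas assoc = assoc_mult_mat[of _ m m _ m _ m] assoc_mult_mat[of _ m m _ m _ 1]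

lemmas distrib = mult_add_distrib_mat[of _ m m _ m] add_mult_distrib_mat[of _ m m _ _ m]
  mult_add_distrib_mat[of _ m m _ 1] add_mult_distrib_mat[of _ m m _ _ 1]

lemmas one_mult [simp] = left_mult_one_mat[of _ m m] right_mult_one_mat[of _ m m]

lemma Alg_carrier [simp]: "a \<in> Alg \<Longrightarrow> a \<in> carrier_mat m m"
  by (induction rule: generated_subalgebra.induct) auto

lemma Alg_dim [simp]: "a \<in> Alg \<Longrightarrow> dim_row a = m" "a \<in> Alg \<Longrightarrow> dim_col a = m"
  using Alg_carrier by blast+

lemma Alg_commutes_if_generator_commutes:
  assumes X: "X \<in> carrier_mat m m" and XA: "X * A = A * X" and a: "a \<in> Alg"
  shows "X * a = a * X"
  using a
proof (induction rule: generated_subalgebra.induct)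
  case (add B C)
  with X show ?case by (simp add: distrib)
next
  case (mult B C)
  have [simp]: "B \<in> carrier_mat m m" "C \<in> carrier_mat m m" using mult.hyps by (auto intro: Alg_carrier)
  have "X * (B * C) = (X * B) * C" using X by (simp add: assoc)
  also have "\<dots> = (B * X) * C" by (simp only: mult.IH(1))
  also have "\<dots> = B * (X * C)" using X by (simp add: assoc)
  also have "\<dots> = B * (C * X)" by (simp only: mult.IH(2))
  also have "\<dots> = (B * C) * X" using X by (simp add: assoc)
  finally show ?case .
next
  case (smult B c)
  with X show ?case by (simp add: mult_smult_distrib[of _ m m _ m] mult_smult_assoc_mat[of _ m m _ m])
qed (use X XA in simp_all)

lemma Alg_commute: "a \<in> Alg \<Longrightarrow> b \<in> Alg \<Longrightarrow> a * b = b * a"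
  by (metis A Alg_carrier Alg_commutes_if_generator_commutes)

lemma Alg_uminus: "a \<in> Alg \<Longrightarrow> - a \<in> Alg"
proof -
  assume "a \<in> Alg"
  then have "(-1) \<cdot>\<^sub>m a \<in> Alg" by (rule generated_subalgebra.smult)
  also have "(-1) \<cdot>\<^sub>m a = - a" by (intro eq_matI) auto
  finally show ?thesis .
qed

lemma eq_if_eq_on_columns:
  fixes X X' :: "'a mat"
  assumes X: "X \<in> carrier_mat m m" and X': "X' \<in> carrier_mat m m"
    and eq: "\<And>Y. Y \<in> carrier_mat m 1 \<Longrightarrow> X * Y = X' * Y"
  shows "X = X'"
proof (rule eq_matI)
  fix i j assume "i < dim_row X'" "j < dim_col X'"
  then have ij: "i < m" "j < m" using X' by auto
  let ?Y = "mat m 1 (\<lambda>(l, _). of_bool (l = j)) :: 'a mat"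
  have entry: "(Z * ?Y) $$ (i, 0) = Z $$ (i, j)" if "Z \<in> carrier_mat m m" for Z :: "'a mat"
  proof -
    have "col ?Y 0 = unit_vec m j" by (rule eq_vecI) (auto simp: unit_vec_def)
    with that ij show ?thesis by simp
  qed
  show "X $$ (i, j) = X' $$ (i, j)"
    using eq[of ?Y] entry[OF X] entry[OF X'] by simp
qed (use X X' in auto)

text \<open>
  If \<open>Y = a E\<close>, then \<open>X Y = X a E = a X E\<close>, so \<open>X\<close> is determined by its value at \<open>E\<close>.
\<close>

lemma Alg_eqI_cyclic:
  assumes X: "X \<in> carrier_mat m m" and X': "X' \<in> carrier_mat m m"
    and "X * A = A * X" "X' * A = A * X'" and XE: "X * E = X' * E"
  shows "X = X'"
proof (rule eq_if_eq_on_columns[OF X X'])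
  fix Y :: "'a mat" assume "Y \<in> carrier_mat m 1"
  then obtain a where a: "a \<in> Alg" "Y = a * E" using cyclic by blast
  have move: "Z * Y = a * (Z * E)" if Z: "Z \<in> carrier_mat m m" and "Z * A = A * Z" for Z
  proof -
    have "Z * Y = (Z * a) * E" using Z a by (simp add: assoc)
    also have "\<dots> = a * (Z * E)"
      using Alg_commutes_if_generator_commutes[OF that a(1)] Z a(1)
      by (simp add: assoc)
    finally show ?thesis .
  qed
  show "X * Y = X' * Y" using assms by (simp add: move)
qed

text \<open>
  Cyclicity gives an \<open>a\<close> in the algebra that agrees with \<open>X\<close> at \<open>E\<close>.
\<close>

lemma centralizer_eq_Alg:
  assumes X: "X \<in> carrier_mat m m" and XA: "X * A = A * X"
  shows "X \<in> Alg"
proof -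
  obtain a where a: "a \<in> Alg" "X * E = a * E" using cyclic[of "X * E"] X by auto
  have "X = a"
    by (rule Alg_eqI_cyclic[OF X Alg_carrier[OF a(1)] XA Alg_commute[OF a(1) generated_subalgebra.gen] a(2)])
  with a(1) show ?thesis by simp
qed

lemma Alg_eq_iff_cyclic: "a \<in> Alg \<Longrightarrow> b \<in> Alg \<Longrightarrow> a * E = b * E \<longleftrightarrow> a = b"
  using Alg_eqI_cyclic[of a b] Alg_commute[OF _ generated_subalgebra.gen] Alg_carrier by metis

text \<open>
  Self-adjointness passes from the generator to products because the algebra is commutative:
  \<open>S (B C)^T = S C^T B^T = C B S = B C S\<close>.
\<close>

lemma Alg_self_adjoint: "a \<in> Alg \<Longrightarrow> S * a\<^sup>T = a * S"
proof (induction rule: generated_subalgebra.induct)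
  case (add B C)
  then show ?case
    by (simp add: transpose_add[of _ m m] distrib)
next
  case (mult B C)
  have "S * (B * C)\<^sup>T = (S * C\<^sup>T) * B\<^sup>T"
    using mult.hyps by (simp add: transpose_mult[of _ m m _ m] assoc)
  also have "\<dots> = C * S * B\<^sup>T" by (simp only: mult.IH(2))
  also have "\<dots> = C * (S * B\<^sup>T)" using mult.hyps by (simp add: assoc)
  also have "\<dots> = C * (B * S)" by (simp only: mult.IH(1))
  also have "\<dots> = (C * B) * S" using mult.hyps by (simp add: assoc)
  also have "\<dots> = (B * C) * S" using mult.hyps Alg_commute[of B C] by simp
  finally show ?case .
next
  case (smult B c)
  have "(c \<cdot>\<^sub>m B)\<^sup>T = c \<cdot>\<^sub>m B\<^sup>T" by auto
  with smult show ?case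
    by (simp add: mult_smult_distrib[of _ m m _ m] mult_smult_assoc_mat[of _ m m _ m])
qed (use AS in simp_all)


lemma T_intertwines: "T * A = A\<^sup>T * T"
proof -
  have "T * A = T * (A * (S * T))" by (simp add: ST)
  also have "\<dots> = T * ((A * S) * T)" by (simp add: assoc)
  also have "\<dots> = (T * S) * (A\<^sup>T * T)" unfolding AS by (simp add: assoc)
  also have "\<dots> = A\<^sup>T * T" by (simp add: TS)
  finally show ?thesis .
qed

lemma ST_cancel: "X \<in> carrier_mat m k \<Longrightarrow> S * (T * X) = X"
  using assoc_mult_mat[OF S T, of X k] by (simp add: ST)

lemma TS_cancel: "X \<in> carrier_mat m k \<Longrightarrow> T * (S * X) = X"
  using assoc_mult_mat[OF T S, of X k] by (simp add: TS)

lemmas cancel [simp] = ST TS ST_cancel[of _ m] ST_cancel[of _ 1] TS_cancel[of _ m] TS_cancel[of _ 1]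

text \<open>
  The conjugate of \<open>[[a, b], [c, d]]\<close> by \<open>diag(1, S)\<close>. An isometry must commute with \<open>diag(A, A^T)\<close>, and \<open>S\<close>
  carries \<open>A^T\<close> to \<open>A\<close> on the second half of the coordinates.
\<close>

definition twisted_block :: "'a mat \<Rightarrow> 'a mat \<Rightarrow> 'a mat \<Rightarrow> 'a mat \<Rightarrow> 'a mat" where
  "twisted_block a b c d = four_block_mat a (b * S) (T * c) (T * d * S)"

text \<open>
  The pairs \<open>(v, w)\<close> and \<open>(v', w')\<close> of elements of the algebra, written as the two columns of a \<open>2m\<close> by \<open>2\<close>
  matrix by means of the cyclic column; the factor \<open>T\<close> makes up for the conjugation in \<open>twisted_block\<close>.
\<close>

definition column_block :: "'a mat \<Rightarrow> 'a mat \<Rightarrow> 'a mat \<Rightarrow> 'a mat \<Rightarrow> 'a mat" where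
  "column_block v w v' w' = four_block_mat (v * E) (v' * E) (T * w * E) (T * w' * E)"

lemma twisted_block_carrier [simp]:
  assumes [simp]: "a \<in> Alg" "d \<in> Alg"
  shows "twisted_block a b c d \<in> carrier_mat (2*m) (2*m)"
  unfolding twisted_block_def mult_2 by (intro four_block_carrier_mat) simp_all

lemma column_block_carrier [simp]:
  assumes [simp]: "v \<in> Alg" "w' \<in> Alg"
  shows "column_block v w v' w' \<in> carrier_mat (2*m) 2"
proof -
  have "column_block v w v' w' \<in> carrier_mat (m + m) (1 + 1)"
    unfolding column_block_def by (intro four_block_carrier_mat) simp_all
  then show ?thesis by (simp add: mult_2)
qed

lemma twisted_block_mult:
  assumes [simp]: "a \<in> Alg" "b \<in> Alg" "c \<in> Alg" "d \<in> Alg" "a' \<in> Alg" "b' \<in> Alg" "c' \<in> Alg" "d' \<in> Alg"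
  shows "twisted_block a b c d * twisted_block a' b' c' d' =
    twisted_block (a * a' + b * c') (a * b' + b * d') (c * a' + d * c') (c * b' + d * d')"
  unfolding twisted_block_def
  by (subst mult_four_block_mat[of _ m m _ m _ m _ _ m _ m]) (simp_all add: assoc distrib)

lemma twisted_block_column_block:
  assumes [simp]: "a \<in> Alg" "b \<in> Alg" "c \<in> Alg" "d \<in> Alg" "v \<in> Alg" "w \<in> Alg" "v' \<in> Alg" "w' \<in> Alg"
  shows "twisted_block a b c d * column_block v w v' w' =
    column_block (a * v + b * w) (c * v + d * w) (a * v' + b * w') (c * v' + d * w')"
  unfolding twisted_block_def column_block_def
  by (subst mult_four_block_mat[of _ m m _ m _ m _ _ 1 _ 1]) (simp_all add: assoc distrib)

lemma column_block_add:
  assumes [simp]: "v \<in> Alg" "w \<in> Alg" "v' \<in> Alg" "w' \<in> Alg" "x \<in> Alg" "y \<in> Alg" "x' \<in> Alg" "y' \<in> Alg"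
  shows "column_block v w v' w' + column_block x y x' y' = column_block (v + x) (w + y) (v' + x') (w' + y')"
  unfolding column_block_def
  by (subst add_four_block_mat[of _ m 1 _ 1 _ m]) (simp_all add: assoc distrib)

lemma twisted_block_one: "twisted_block (1\<^sub>m m) (0\<^sub>m m m) (0\<^sub>m m m) (1\<^sub>m m) = 1\<^sub>m (2*m)"
proof -
  have "0\<^sub>m m m * S = 0\<^sub>m m m" "T * 0\<^sub>m m m = 0\<^sub>m m m" by (auto simp: left_mult_zero_mat[OF S] right_mult_zero_mat[OF T])
  then show ?thesis unfolding twisted_block_def mult_2 by simp
qed

lemma twisted_block_eq_iff:
  assumes [simp]: "a \<in> Alg" "b \<in> Alg" "c \<in> Alg" "d \<in> Alg" "a' \<in> Alg" "b' \<in> Alg" "c' \<in> Alg" "d' \<in> Alg"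
  shows "twisted_block a b c d = twisted_block a' b' c' d' \<longleftrightarrow> a = a' \<and> b = b' \<and> c = c' \<and> d = d'"
proof
  assume "twisted_block a b c d = twisted_block a' b' c' d'"
  then have eq: "a = a' \<and> b * S = b' * S \<and> T * c = T * c' \<and> T * (d * S) = T * (d' * S)"
    unfolding twisted_block_def
    by (subst (asm) four_block_mat_eq_iff[of _ m m _ m _ m]) (simp_all add: assoc)
  have rcancel: "x = y" if "x * S = y * S" and [simp]: "x \<in> carrier_mat m m" "y \<in> carrier_mat m m" for x y
  proof -
    have "x * S * T = y * S * T" using that by simp
    then show ?thesis by (simp add: assoc)
  qed
  have lcancel: "x = y" if "T * x = T * y" and [simp]: "x \<in> carrier_mat m m" "y \<in> carrier_mat m m" for x y
  proof -
    have "S * (T * x) = S * (T * y)" using that by simp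
    then show ?thesis by simp
  qed
  show "a = a' \<and> b = b' \<and> c = c' \<and> d = d'"
    using eq rcancel[of b b'] lcancel[of c c'] rcancel[OF lcancel, of d d'] by simp
qed simp

lemma column_block_eq_iff:
  assumes [simp]: "v \<in> Alg" "w \<in> Alg" "v' \<in> Alg" "w' \<in> Alg" "x \<in> Alg" "y \<in> Alg" "x' \<in> Alg" "y' \<in> Alg"
  shows "column_block v w v' w' = column_block x y x' y' \<longleftrightarrow> v = x \<and> w = y \<and> v' = x' \<and> w' = y'"
proof
  assume "column_block v w v' w' = column_block x y x' y'"
  then have eq: "v * E = x * E \<and> v' * E = x' * E \<and> T * (w * E) = T * (y * E) \<and> T * (w' * E) = T * (y' * E)"
    unfolding column_block_def
    by (subst (asm) four_block_mat_eq_iff[of _ m 1 _ 1 _ m]) (simp_all add: assoc)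
  have lcancel: "u * E = z * E" if "T * (u * E) = T * (z * E)" and [simp]: "u \<in> Alg" "z \<in> Alg" for u z
  proof -
    have "S * (T * (u * E)) = S * (T * (z * E))" using that by simp
    then show ?thesis by simp
  qed
  show "v = x \<and> w = y \<and> v' = x' \<and> w' = y'"
    using eq lcancel[of w y] lcancel[of w' y'] by (simp add: Alg_eq_iff_cyclic)
qed simp

lemma column_block_surj:
  assumes W: "W \<in> carrier_mat (2*m) 2"
  shows "\<exists>v\<in>Alg. \<exists>w\<in>Alg. \<exists>v'\<in>Alg. \<exists>w'\<in>Alg. W = column_block v w v' w'"
proof -
  obtain P Q R V where s: "split_block W m 1 = (P, Q, R, V)" by (metis prod_cases4)
  have "dim_row W = m + m" "dim_col W = 1 + 1" using W by auto
  note blk = split_block[OF s this]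
  obtain v where v: "v \<in> Alg" "P = v * E" using cyclic blk(1) by blast
  obtain v' where v': "v' \<in> Alg" "Q = v' * E" using cyclic blk(2) by blast
  obtain w where w: "w \<in> Alg" "S * R = w * E" using cyclic[of "S * R"] blk(3) by auto
  obtain w' where w': "w' \<in> Alg" "S * V = w' * E" using cyclic[of "S * V"] blk(4) by auto
  have "R = T * w * E" "V = T * w' * E"
    using w w' TS_cancel[OF blk(3)] TS_cancel[OF blk(4)] by (simp_all add: assoc)
  with blk(5) v v' w w' show ?thesis unfolding column_block_def by blast
qed

lemma skew_block_one: "skew_block (1\<^sub>m m) = four_block_mat (0\<^sub>m m m) (1\<^sub>m m) (- 1\<^sub>m m) (0\<^sub>m m m)"
  by (simp add: skew_block_def)

lemma transpose_twisted_block: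
  assumes [simp]: "a \<in> Alg" "b \<in> Alg" "c \<in> Alg" "d \<in> Alg"
  shows "(twisted_block a b c d)\<^sup>T = four_block_mat (T * a * S) (T * c) (b * S) d"
proof -
  have adj: "x\<^sup>T = T * (x * S)" if [simp]: "x \<in> Alg" for x
    using TS_cancel[of "x\<^sup>T" m] by (simp add: Alg_self_adjoint)
  show ?thesis
    unfolding twisted_block_def
    by (subst transpose_four_block_mat[of _ m m _ m _ m])
       (simp_all add: transpose_mult[of _ m m _ m] assoc adj S_sym T_sym)
qed

text \<open>
  Modulo the identification by \<open>S\<close> the product \<open>M J M^T\<close> has the blocks \<open>ab - ba\<close>, \<open>ad - bc\<close>, \<open>cb - da\<close> and
  \<open>cd - dc\<close>. By commutativity the diagonal ones vanish and the other two are opposite to each other.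
\<close>

lemma twisted_block_preserves_form_iff:
  assumes [simp]: "a \<in> Alg" "b \<in> Alg" "c \<in> Alg" "d \<in> Alg"
  shows "twisted_block a b c d * skew_block (1\<^sub>m m) * (twisted_block a b c d)\<^sup>T = skew_block (1\<^sub>m m)
    \<longleftrightarrow> a * d - b * c = 1\<^sub>m m"
proof -
  have swap: "x * (y * S) = y * (x * S)" if [simp]: "x \<in> Alg" "y \<in> Alg" for x y
    using Alg_commute[of x y] by (simp add: assoc[symmetric])
  have 11: "- (b * S) * (T * a * S) + a * (b * S) = 0\<^sub>m m m"
    by (rule eq_matI) (simp_all add: assoc swap[of b a])
  have 12: "- (b * S) * (T * c) + a * d = a * d - b * c"
    by (rule eq_matI) (simp_all add: assoc)
  have 21: "- (T * d * S) * (T * a * S) + T * c * (b * S) = - (T * (a * d - b * c) * S)"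
  proof -
    have "T * (a * d - b * c) * S = T * (d * (a * S)) - T * (c * (b * S))"
      using Alg_commute[of a d] Alg_commute[of b c]
      by (simp add: assoc mult_minus_distrib_mat[of _ m m _ m] minus_mult_distrib_mat[of _ m m _ _ m])
    then show ?thesis by (intro eq_matI) (simp_all add: assoc)
  qed
  have 22: "- (T * d * S) * (T * c) + T * c * d = 0\<^sub>m m m"
    using Alg_commute[of c d] by (intro eq_matI) (simp_all add: assoc)
  have "twisted_block a b c d * skew_block (1\<^sub>m m) = four_block_mat (- (b * S)) a (- (T * d * S)) (T * c)"
    unfolding twisted_block_def skew_block_one
    by (subst mult_four_block_mat[of _ m m _ m _ m _ _ m _ m]) (simp_all add: assoc)
  also have "\<dots> * (twisted_block a b c d)\<^sup>T =
      four_block_mat (0\<^sub>m m m) (a * d - b * c) (- (T * (a * d - b * c) * S)) (0\<^sub>m m m)"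
    unfolding transpose_twisted_block[OF assms]
    by (subst mult_four_block_mat[of _ m m _ m _ m _ _ m _ m])
       (simp_all only: 11 12 21 22, simp_all add: uminus_carrier_mat)
  finally have form: "twisted_block a b c d * skew_block (1\<^sub>m m) * (twisted_block a b c d)\<^sup>T =
      four_block_mat (0\<^sub>m m m) (a * d - b * c) (- (T * (a * d - b * c) * S)) (0\<^sub>m m m)" .
  show ?thesis
    unfolding form unfolding skew_block_one
    by (subst four_block_mat_eq_iff[of _ m m _ m _ m]) (auto simp: minus_carrier_mat)
qed

text \<open>
  The inverse is given by the adjugate \<open>[[d, -b], [-c, a]]\<close>.
\<close>

lemma twisted_block_invertible:
  assumes [simp]: "a \<in> Alg" "b \<in> Alg" "c \<in> Alg" "d \<in> Alg" and det: "a * d - b * c = 1\<^sub>m m"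
  shows "twisted_block a b c d \<in> carrier (GL (2*m))"
proof -
  have [simp]: "- b \<in> Alg" "- c \<in> Alg" by (simp_all add: Alg_uminus)
  have det': "a * d + - (b * c) = 1\<^sub>m m"
    using add_uminus_minus_mat[of "a * d" m m "b * c"] det by simp
  have zero: "- (x * y) + y * x = 0\<^sub>m m m" "x * y + - (y * x) = 0\<^sub>m m m" if "x \<in> Alg" "y \<in> Alg" for x y
    using Alg_commute[OF that] that by (auto intro!: eq_matI)
  have comm: "- (b * c) + d * a = 1\<^sub>m m" "- (c * b) + d * a = 1\<^sub>m m" "d * a + - (b * c) = 1\<^sub>m m"
      "- (c * b) + a * d = 1\<^sub>m m"
    using det' comm_add_mat[of "a * d" m m "- (b * c)"] Alg_commute[of a d] Alg_commute[of b c] by simp_all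
  have "twisted_block a b c d * twisted_block d (- b) (- c) a = 1\<^sub>m (2*m)"
    by (simp add: twisted_block_mult det' zero comm twisted_block_one)
  moreover have "twisted_block d (- b) (- c) a * twisted_block a b c d = 1\<^sub>m (2*m)"
    by (simp add: twisted_block_mult det' zero comm twisted_block_one)
  ultimately show ?thesis
    unfolding GL_carrier_iff using twisted_block_carrier[of a d] twisted_block_carrier[of d a] by auto
qed


lemma skew_block_eq: "X \<in> carrier_mat m m \<Longrightarrow> skew_block X = four_block_mat (0\<^sub>m m m) X (- X\<^sup>T) (0\<^sub>m m m)"
  by (auto simp: skew_block_def)

text \<open>
  The operator that transports the first form to the second one.
\<close>

definition block_diag :: "'a mat" where
  "block_diag = four_block_mat A (0\<^sub>m m m) (0\<^sub>m m m) A\<^sup>T"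

lemma block_diag_carrier [simp]: "block_diag \<in> carrier_mat (2*m) (2*m)"
  unfolding block_diag_def mult_2 by (intro four_block_carrier_mat) simp_all

lemma skew_block_A: "block_diag * skew_block (1\<^sub>m m) = skew_block A"
  unfolding block_diag_def skew_block_one skew_block_eq[OF A]
  by (subst mult_four_block_mat[of _ m m _ m _ m _ _ m _ m]) simp_all

lemma twisted_block_commutes:
  assumes [simp]: "a \<in> Alg" "b \<in> Alg" "c \<in> Alg" "d \<in> Alg"
  shows "twisted_block a b c d * block_diag = block_diag * twisted_block a b c d"
proof -
  have comm: "x * A = A * x" "x * (A * S) = A * (x * S)" if [simp]: "x \<in> Alg" for x
  proof -
    show *: "x * A = A * x" by (intro Alg_commute that generated_subalgebra.gen)
    show "x * (A * S) = A * (x * S)" using * by (simp add: assoc[symmetric])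
  qed
  have TA: "A\<^sup>T * (T * x) = T * (A * x)" if "x \<in> carrier_mat m m" for x
    using that T_intertwines by (simp add: assoc[symmetric])
  show ?thesis
    unfolding twisted_block_def block_diag_def
    by (subst (1 2) mult_four_block_mat[of _ m m _ m _ m _ _ m _ m])
       (simp_all add: assoc AS[symmetric] comm TA)
qed

text \<open>
  Both \<open>M N J M^T\<close> and \<open>N M J M^T\<close> equal \<open>N J\<close>, for \<open>N = diag(A, A^T)\<close>. The factor \<open>J M^T\<close> can be cancelled,
  so \<open>M\<close> commutes with \<open>N\<close>, and each block becomes an element of the centralizer of \<open>A\<close> once \<open>S\<close> or \<open>T\<close>
  is multiplied to the sides on which it meets \<open>A^T\<close>.
\<close>

lemma isometries_eq_twisted_blocks:
  "M \<in> carrier (GL (2*m)) \<and> M * skew_block (1\<^sub>m m) * M\<^sup>T = skew_block (1\<^sub>m m) \<and> M * skew_block A * M\<^sup>T = skew_block A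
   \<longleftrightarrow> (\<exists>a\<in>Alg. \<exists>b\<in>Alg. \<exists>c\<in>Alg. \<exists>d\<in>Alg. M = twisted_block a b c d \<and> a * d - b * c = 1\<^sub>m m)"
    (is "?L \<longleftrightarrow> ?R")
proof -
  let ?J = "skew_block (1\<^sub>m m) :: 'a mat"
  have J [simp]: "?J \<in> carrier_mat (2*m) (2*m)" by simp
  note [simp] = carrier_matD[OF J]
  note assoc2 = assoc_mult_mat[of _ "2*m" "2*m" _ "2*m" _ "2*m"]
  note carrier2 = mult_carrier_mat[of _ "2*m" "2*m" _ "2*m"]
  show ?thesis
  proof
    assume L: ?L
    then obtain P where M [simp]: "M \<in> carrier_mat (2*m) (2*m)" and P [simp]: "P \<in> carrier_mat (2*m) (2*m)"
      and PM: "P * M = 1\<^sub>m (2*m)" unfolding GL_carrier_iff by blast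
    have MP: "M\<^sup>T * P\<^sup>T = 1\<^sub>m (2*m)"
      using arg_cong[OF PM, of transpose_mat] by (simp add: transpose_mult[OF P M])
    have JJ: "?J * (- ?J) = 1\<^sub>m (2*m)"
    proof -
      have "?J * (- ?J) = - (?J * ?J)" by simp
      also have "?J * ?J = four_block_mat (- 1\<^sub>m m) (0\<^sub>m m m) (0\<^sub>m m m) (- 1\<^sub>m m)"
        unfolding skew_block_one
        by (subst mult_four_block_mat[of _ m m _ m _ m _ _ m _ m]) simp_all
      also have "- \<dots> = 1\<^sub>m (2*m)" by (rule eq_matI) auto
      finally show ?thesis .
    qed
    \<comment> \<open>The inverse of \<open>J M^T\<close> is \<open>(M^-1)^T J^-1\<close>, where \<open>J^-1 = -J\<close>.\<close>
    have cancel_right: "X * ?J * M\<^sup>T * (P\<^sup>T * (- ?J)) = X" if X: "X \<in> carrier_mat (2*m) (2*m)" for X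
    proof -
      have "X * ?J * M\<^sup>T * (P\<^sup>T * (- ?J)) = X * (?J * ((M\<^sup>T * P\<^sup>T) * (- ?J)))"
        using X by (simp add: assoc2 carrier2 del: uminus_mult_right_mat)
      also have "\<dots> = X * 1\<^sub>m (2*m)" unfolding MP using left_mult_one_mat[of "- ?J" "2*m" "2*m"] JJ by simp
      finally show ?thesis using right_mult_one_mat[OF X] by simp
    qed
    have "M * block_diag * ?J * M\<^sup>T = M * skew_block A * M\<^sup>T"
      by (simp add: skew_block_A[symmetric] assoc2 carrier2)
    also have "\<dots> = block_diag * (M * ?J * M\<^sup>T)" using L by (simp add: skew_block_A)
    also have "\<dots> = block_diag * M * ?J * M\<^sup>T" by (simp add: assoc2 carrier2)
    finally have "M * block_diag * ?J * M\<^sup>T * (P\<^sup>T * (- ?J)) = block_diag * M * ?J * M\<^sup>T * (P\<^sup>T * (- ?J))"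
      by simp
    then have comm: "M * block_diag = block_diag * M"
      by (simp only: cancel_right carrier2[OF M block_diag_carrier] carrier2[OF block_diag_carrier M])
    obtain p q r s where sp: "split_block M m m = (p, q, r, s)" by (metis prod_cases4)
    have "dim_row M = m + m" "dim_col M = m + m" using carrier_matD[OF M] by simp_all
    note blk = split_block[OF sp this]
    note [simp] = blk(1-4) right_mult_zero_mat[of _ m m] left_mult_zero_mat[of _ m m]
      right_add_zero_mat[of _ m m] left_add_zero_mat[of _ m m]
    have "four_block_mat (p * A) (q * A\<^sup>T) (r * A) (s * A\<^sup>T) = M * block_diag"
      unfolding blk(5) block_diag_def
      by (subst mult_four_block_mat[of _ m m _ m _ m _ _ m _ m]) simp_all
    also have "\<dots> = four_block_mat (A * p) (A * q) (A\<^sup>T * r) (A\<^sup>T * s)"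
      unfolding comm unfolding blk(5) block_diag_def
      by (subst mult_four_block_mat[of _ m m _ m _ m _ _ m _ m]) simp_all
    finally have eqs: "p * A = A * p" "q * A\<^sup>T = A * q" "r * A = A\<^sup>T * r" "s * A\<^sup>T = A\<^sup>T * s"
      by (simp_all add: four_block_mat_eq_iff[of _ m m _ m _ m])
    have "p \<in> Alg" using eqs(1) by (intro centralizer_eq_Alg) simp_all
    moreover have "q * T \<in> Alg"
    proof (rule centralizer_eq_Alg)
      have "q * T * A = q * A\<^sup>T * T" by (simp add: assoc T_intertwines)
      then show "q * T * A = A * (q * T)" by (simp add: eqs(2) assoc)
    qed simp
    moreover have "S * r \<in> Alg"
    proof (rule centralizer_eq_Alg)
      have "S * r * A = S * A\<^sup>T * r" by (simp add: assoc eqs(3))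
      then show "S * r * A = A * (S * r)" by (simp add: AS[symmetric] assoc)
    qed simp
    moreover have "S * s * T \<in> Alg"
    proof (rule centralizer_eq_Alg)
      have "S * s * T * A = S * (s * A\<^sup>T) * T" by (simp add: assoc T_intertwines)
      also have "\<dots> = S * A\<^sup>T * (s * T)" by (simp add: assoc eqs(4))
      finally show "S * s * T * A = A * (S * s * T)" by (simp add: AS[symmetric] assoc)
    qed simp
    moreover have Mt: "M = twisted_block p (q * T) (S * r) (S * s * T)"
      unfolding twisted_block_def blk(5) by (simp add: assoc)
    moreover have "p * (S * s * T) - (q * T) * (S * r) = 1\<^sub>m m"
      using L calculation by (subst twisted_block_preserves_form_iff[symmetric]) simp_all
    ultimately show ?R by blast
  next
    assume ?R
    then obtain a b c d where [simp]: "a \<in> Alg" "b \<in> Alg" "c \<in> Alg" "d \<in> Alg"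
      and M: "M = twisted_block a b c d" and det: "a * d - b * c = 1\<^sub>m m" by blast
    have [simp]: "M \<in> carrier_mat (2*m) (2*m)" by (simp add: M)
    have iso: "M * ?J * M\<^sup>T = ?J" unfolding M using det by (subst twisted_block_preserves_form_iff) simp_all
    have "M * skew_block A * M\<^sup>T = (M * block_diag) * ?J * M\<^sup>T"
      by (simp add: skew_block_A[symmetric] assoc2 carrier2)
    also have "\<dots> = block_diag * (M * ?J * M\<^sup>T)"
      unfolding twisted_block_commutes[of a b c d, simplified, folded M] by (simp add: assoc2 carrier2)
    also have "\<dots> = skew_block A" unfolding iso by (rule skew_block_A)
    finally show ?L using iso det twisted_block_invertible[of a b c d] M by simp
  qed
qed

end

section \<open>The Hankel matrices of a companion matrix\<close>

lemma mult_mat_entry: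
  assumes "X \<in> carrier_mat n k" "Y \<in> carrier_mat k l" "i < n" "j < l"
  shows "(X * Y) $$ (i, j) = (\<Sum>q<k. X $$ (i, q) * Y $$ (q, j))"
  using assms by (auto simp: scalar_prod_def lessThan_atLeast0)

context
  fixes p :: "int poly" and m :: nat
  assumes m_pos: "m \<ge> 1" and deg: "degree p = m" and monic: "lead_coeff p = 1"
begin

definition companion :: "'a::comm_ring_1 mat" where
  "companion = map_mat of_int (companion_mat p)"

definition last_col :: "'a::comm_ring_1 mat" where
  "last_col = mat m 1 (\<lambda>(i, _). of_bool (Suc i = m))"

text \<open>
  The columns \<open>K^n E\<close>, where \<open>E\<close> is the last unit column.
\<close>

definition krylov :: "nat \<Rightarrow> 'a::comm_ring_1 mat" where
  "krylov n = ((\<lambda>X. companion * X) ^^ n) last_col"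

text \<open>
  The columns of this matrix are \<open>E, K E, \<dots>, K^(m-1) E\<close> (see \<open>hankel_entry\<close>); the form chosen here makes its
  symmetry evident.
\<close>

definition hankel :: "'a::comm_ring_1 mat" where
  "hankel = mat m m (\<lambda>(i, j). krylov (i + j) $$ (0, 0))"

definition coeff_hankel :: "'a::comm_ring_1 mat" where
  "coeff_hankel = mat m m (\<lambda>(i, j). of_int (coeff p (Suc (i + j))))"

lemma companion_carrier: "companion \<in> carrier_mat m m"
  by (simp add: companion_def companion_mat_def deg)

lemma companion_entry:
  "i < m \<Longrightarrow> j < m \<Longrightarrow> (companion :: 'a::comm_ring_1 mat) $$ (i, j) =
     (if Suc i = m then - of_int (coeff p j) else of_bool (j = Suc i))"
  by (simp add: companion_def companion_mat_def deg)

lemma last_col_carrier: "last_col \<in> carrier_mat m 1"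
  by (simp add: last_col_def)

lemma krylov_carrier: "krylov n \<in> carrier_mat m 1"
proof (induction n)
  case 0
  show ?case by (simp add: krylov_def last_col_def)
next
  case (Suc n)
  then show ?case using mult_carrier_mat[OF companion_carrier] by (simp add: krylov_def)
qed

lemma krylov_Suc: "krylov (Suc n) = companion * krylov n"
  by (simp add: krylov_def)

text \<open>
  All rows of \<open>K\<close> but the last one shift the coordinates, so a coordinate of \<open>K^n E\<close> is the top
  coordinate of a later member of the sequence.
\<close>

lemma krylov_entry: "i < m \<Longrightarrow> krylov n $$ (i, 0) = (krylov (i + n) $$ (0, 0) :: 'a::comm_ring_1)"
proof (induction i arbitrary: n)
  case (Suc i)
  have "krylov (Suc n) $$ (i, 0) = (\<Sum>l<m. companion $$ (i, l) * (krylov n $$ (l, 0) :: 'a))"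
    unfolding krylov_Suc using Suc.prems by (intro mult_mat_entry[OF companion_carrier krylov_carrier]) simp_all
  also have "\<dots> = (\<Sum>l<m. if l = Suc i then krylov n $$ (l, 0) else 0)"
    using Suc.prems by (intro sum.cong) (auto simp: companion_entry)
  also have "\<dots> = krylov n $$ (Suc i, 0)" using Suc.prems by simp
  finally show ?case using Suc.IH[of "Suc n"] Suc.prems by simp
qed simp

lemma hankel_entry: "i < m \<Longrightarrow> j < m \<Longrightarrow> hankel $$ (i, j) = krylov j $$ (i, 0)"
  by (simp add: hankel_def krylov_entry[of i j])

lemma coeff_hankel_entry: "i < m \<Longrightarrow> j < m \<Longrightarrow> coeff_hankel $$ (i, j) = of_int (coeff p (Suc (i + j)))"
  by (simp add: coeff_hankel_def)

lemma hankel_sym: "hankel\<^sup>T = hankel"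
  by (rule eq_matI) (auto simp: hankel_def add.commute)

lemma coeff_hankel_sym: "coeff_hankel\<^sup>T = coeff_hankel"
  by (rule eq_matI) (auto simp: coeff_hankel_def add.commute)

lemma hankel_carrier: "hankel \<in> carrier_mat m m" "coeff_hankel \<in> carrier_mat m m"
  by (auto simp: hankel_def coeff_hankel_def)

lemmas hankel_dims [simp] = carrier_matD[OF companion_carrier] carrier_matD[OF hankel_carrier(1)]
  carrier_matD[OF hankel_carrier(2)]

text \<open>
  The product \<open>K S\<close> is again a Hankel matrix, hence symmetric, and \<open>(K S)^T = S K^T\<close>.
\<close>

lemma companion_hankel: "companion * hankel = (hankel * companion\<^sup>T :: 'a::comm_ring_1 mat)"
proof -
  have entry: "(companion * hankel) $$ (i, j) = (krylov (Suc (i + j)) $$ (0, 0) :: 'a)" if "i < m" "j < m" for i j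
  proof -
    have "(companion * hankel) $$ (i, j) = (\<Sum>l<m. companion $$ (i, l) * (krylov j $$ (l, 0) :: 'a))"
      using that by (subst mult_mat_entry[OF companion_carrier hankel_carrier(1)]) (simp_all add: hankel_entry)
    also have "\<dots> = krylov (Suc j) $$ (i, 0)"
      unfolding krylov_Suc using that by (intro mult_mat_entry[OF companion_carrier krylov_carrier, symmetric]) simp_all
    finally show ?thesis using krylov_entry[OF that(1), of "Suc j"] by simp
  qed
  have "(companion * hankel)\<^sup>T = (companion * hankel :: 'a mat)"
  proof (rule eq_matI)
    fix i j assume "i < dim_row (companion * hankel :: 'a mat)" "j < dim_col (companion * hankel :: 'a mat)"
    then have ij: "i < m" "j < m" by simp_all
    have "(companion * hankel)\<^sup>T $$ (i, j) = (companion * hankel :: 'a mat) $$ (j, i)"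
      using ij by (intro index_transpose_mat(1)) simp_all
    then show "(companion * hankel)\<^sup>T $$ (i, j) = (companion * hankel :: 'a mat) $$ (i, j)"
      using ij by (simp only: entry add.commute[of j i])
  qed simp_all
  moreover have "(companion * hankel)\<^sup>T = (hankel * companion\<^sup>T :: 'a mat)"
    by (simp add: transpose_mult[OF companion_carrier hankel_carrier(1)] hankel_sym)
  ultimately show ?thesis by simp
qed

text \<open>
  With \<open>c_j\<close> the coefficients of the polynomial, the column \<open>f_i = \<Sum>\<^sub>j c_(i+j+1) K^j E\<close> is the value at \<open>E\<close> of
  a Horner polynomial of \<open>K\<close>. These columns satisfy \<open>f_(i-1) = K f_i + c_i E\<close>, and so do the unit
  columns, by the shape of a companion matrix. Descending induction from \<open>f_(m-1) = E\<close> shows that \<open>f_i\<close> is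
  the \<open>i\<close>-th unit column.
\<close>

lemma horner_columns:
  assumes "i < m" "l < m"
  shows "(\<Sum>j<m. krylov j $$ (l, 0) * of_int (coeff p (Suc (i + j)))) = (of_bool (l = i) :: 'a::comm_ring_1)"
  using assms
proof (induction "m - i" arbitrary: i l)
  case (Suc n)
  have top: "coeff p m = 1" using monic deg by simp
  have high: "coeff p j = 0" if "j > m" for j using that deg by (simp add: coeff_eq_0)
  show ?case
  proof (cases "Suc i = m")
    case True
    have "(\<Sum>j<m. krylov j $$ (l, 0) * of_int (coeff p (Suc (i + j)))) =
        (\<Sum>j<m. if j = 0 then krylov 0 $$ (l, 0) else 0 :: 'a)"
      using True by (intro sum.cong) (auto simp: top high simp flip: add_Suc)
    also have "\<dots> = krylov 0 $$ (l, 0)" using m_pos by simp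
    also have "\<dots> = of_bool (l = i)" using Suc.prems True by (auto simp: krylov_def last_col_def)
    finally show ?thesis .
  next
    case False
    then have i: "Suc i < m" using Suc.prems by simp
    obtain m' where m': "m = Suc m'" using m_pos by (cases m) auto
    have "(\<Sum>j<m. krylov j $$ (l, 0) * of_int (coeff p (Suc (i + j)))) =
        krylov 0 $$ (l, 0) * of_int (coeff p (Suc i)) +
        (\<Sum>j<m'. krylov (Suc j) $$ (l, 0) * of_int (coeff p (Suc (Suc i + j))) :: 'a)"
      unfolding m' by (subst sum.lessThan_Suc_shift) simp
    also have "(\<Sum>j<m'. krylov (Suc j) $$ (l, 0) * of_int (coeff p (Suc (Suc i + j))) :: 'a) =
        (\<Sum>j<m. krylov (Suc j) $$ (l, 0) * of_int (coeff p (Suc (Suc i + j))))"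
      unfolding m' using high[of "Suc (Suc i + m')"] m' by simp
    also have "\<dots> = (\<Sum>j<m. \<Sum>q<m. companion $$ (l, q) * (krylov j $$ (q, 0) * of_int (coeff p (Suc (Suc i + j)))))"
      unfolding krylov_Suc using Suc.prems
      by (intro sum.cong refl) (simp add: mult_mat_entry[OF companion_carrier krylov_carrier] sum_distrib_right mult.assoc)
    also have "\<dots> = (\<Sum>q<m. companion $$ (l, q) * (\<Sum>j<m. krylov j $$ (q, 0) * of_int (coeff p (Suc (Suc i + j)))))"
      by (subst sum.swap) (simp add: sum_distrib_left)
    also have "\<dots> = (\<Sum>q<m. companion $$ (l, q) * of_bool (q = Suc i))"
      using Suc.hyps i by (intro sum.cong refl arg_cong2[of _ _ _ _ "(*)"] Suc.hyps(1)) auto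
    also have "\<dots> = companion $$ (l, Suc i)" using i by simp
    also have "krylov 0 $$ (l, 0) * of_int (coeff p (Suc i)) + companion $$ (l, Suc i) = (of_bool (l = i) :: 'a)"
      using i Suc.prems by (auto simp: companion_entry krylov_def last_col_def)
    finally show ?thesis .
  qed
qed simp

lemma hankel_inverse:
  "hankel * coeff_hankel = (1\<^sub>m m :: 'a::comm_ring_1 mat)" "coeff_hankel * hankel = (1\<^sub>m m :: 'a mat)"
proof -
  show right: "hankel * coeff_hankel = (1\<^sub>m m :: 'a mat)"
  proof (rule eq_matI)
    fix l i assume "l < dim_row (1\<^sub>m m :: 'a mat)" "i < dim_col (1\<^sub>m m :: 'a mat)"
    then have li: "l < m" "i < m" by simp_all
    have "(hankel * coeff_hankel) $$ (l, i) = (\<Sum>j<m. krylov j $$ (l, 0) * (of_int (coeff p (Suc (i + j))) :: 'a))"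
      using li by (subst mult_mat_entry[OF hankel_carrier]) (simp_all add: hankel_entry coeff_hankel_entry add.commute)
    then show "(hankel * coeff_hankel) $$ (l, i) = (1\<^sub>m m :: 'a mat) $$ (l, i)"
      using li by (simp add: horner_columns)
  qed simp_all
  show "coeff_hankel * hankel = (1\<^sub>m m :: 'a mat)"
    using arg_cong[OF right, of transpose_mat]
    by (simp add: transpose_mult[OF hankel_carrier] hankel_sym coeff_hankel_sym)
qed

lemma krylov_in_cyclic_module:
  "\<exists>a\<in>generated_subalgebra m companion. krylov n = a * (last_col :: 'a::comm_ring_1 mat)"
proof (induction n)
  case 0
  have "krylov 0 = 1\<^sub>m m * (last_col :: 'a mat)"
    by (simp add: krylov_def left_mult_one_mat[OF last_col_carrier])
  then show ?case by (auto intro: generated_subalgebra.one)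
next
  case (Suc n)
  then obtain a where a: "a \<in> generated_subalgebra m companion" "krylov n = a * (last_col :: 'a mat)" by blast
  have "a \<in> carrier_mat m m"
    using a(1) by (induction rule: generated_subalgebra.induct) (auto simp: companion_carrier)
  then have "krylov (Suc n) = (companion * a) * last_col"
    unfolding krylov_Suc a(2)
    by (intro assoc_mult_mat[OF companion_carrier _ last_col_carrier, symmetric])
  with a(1) show ?case by (auto intro: generated_subalgebra.mult generated_subalgebra.gen)
qed

text \<open>
  The columns of the invertible matrix \<open>S\<close> are values of \<open>k[K]\<close> at \<open>E\<close>: if \<open>x = T Y\<close>, then
  \<open>Y = S x = \<Sum>\<^sub>j x_j K^j E\<close>.
\<close>

lemma last_col_cyclic:
  assumes Y: "Y \<in> carrier_mat m 1"
  shows "\<exists>a\<in>generated_subalgebra m companion. Y = a * (last_col :: 'a::comm_ring_1 mat)"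
proof -
  have gen_carrier: "a \<in> carrier_mat m m" if "a \<in> generated_subalgebra m companion" for a :: "'a mat"
    using that by (induction rule: generated_subalgebra.induct) (auto simp: companion_carrier)
  define x where "x = coeff_hankel * Y"
  have x: "x \<in> carrier_mat m 1" unfolding x_def by (rule mult_carrier_mat[OF hankel_carrier(2) Y])
  have partial: "\<exists>a\<in>generated_subalgebra m companion.
      mat m 1 (\<lambda>(i, _). \<Sum>j<n. x $$ (j, 0) * krylov j $$ (i, 0)) = a * last_col" for n
  proof (induction n)
    case 0
    have "(0::'a) \<cdot>\<^sub>m 1\<^sub>m m \<in> generated_subalgebra m companion"
      by (intro generated_subalgebra.smult generated_subalgebra.one)
    moreover have "mat m 1 (\<lambda>(i, _). \<Sum>j<0. x $$ (j, 0) * krylov j $$ (i, 0)) = ((0::'a) \<cdot>\<^sub>m 1\<^sub>m m) * last_col"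
      using last_col_carrier by (intro eq_matI) (auto simp: mult_mat_entry[OF _ last_col_carrier, of _ m])
    ultimately show ?case by blast
  next
    case (Suc n)
    then obtain a where a: "a \<in> generated_subalgebra m companion"
      "mat m 1 (\<lambda>(i, _). \<Sum>j<n. x $$ (j, 0) * krylov j $$ (i, 0)) = a * last_col" by blast
    obtain b where b: "b \<in> generated_subalgebra m companion" "krylov n = b * (last_col :: 'a mat)"
      using krylov_in_cyclic_module by blast
    let ?c = "a + x $$ (n, 0) \<cdot>\<^sub>m b"
    have "?c * last_col = a * last_col + x $$ (n, 0) \<cdot>\<^sub>m (b * last_col)"
      using gen_carrier[OF a(1)] gen_carrier[OF b(1)]
      by (simp add: last_col_carrier add_mult_distrib_mat[of _ m m _ _ 1] mult_smult_assoc_mat[of _ m m _ 1])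
    also have "\<dots> = mat m 1 (\<lambda>(i, _). \<Sum>j<Suc n. x $$ (j, 0) * krylov j $$ (i, 0))"
      unfolding a(2)[symmetric] b(2)[symmetric] using carrier_matD[OF krylov_carrier[of n]] by (intro eq_matI) auto
    finally show ?case using a(1) b(1)
      by (intro bexI[of _ ?c]) (auto intro: generated_subalgebra.add generated_subalgebra.smult)
  qed
  have "Y = hankel * x"
    using assoc_mult_mat[OF hankel_carrier Y] left_mult_one_mat[OF Y] by (simp add: x_def hankel_inverse)
  also have "\<dots> = mat m 1 (\<lambda>(i, _). \<Sum>j<m. x $$ (j, 0) * krylov j $$ (i, 0))"
  proof (rule eq_matI)
    fix i j assume "i < dim_row (mat m 1 (\<lambda>(i, _). \<Sum>j<m. x $$ (j, 0) * krylov j $$ (i, 0)))"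
      "j < dim_col (mat m 1 (\<lambda>(i, _). \<Sum>j<m. x $$ (j, 0) * krylov j $$ (i, 0)))"
    then have "i < m" "j = 0" by auto
    then show "(hankel * x) $$ (i, j) = mat m 1 (\<lambda>(i, _). \<Sum>j<m. x $$ (j, 0) * krylov j $$ (i, 0)) $$ (i, j)"
      by (subst mult_mat_entry[OF hankel_carrier(1) x]) (simp_all add: hankel_entry mult.commute)
  qed (use x in simp_all)
  finally show ?thesis using partial[of m] by simp
qed

lemma companion_cyclic_self_adjoint:
  "cyclic_self_adjoint m (map_mat of_int (companion_mat p)) hankel coeff_hankel (last_col :: 'a::comm_ring_1 mat)"
  unfolding companion_def[symmetric]
  by unfold_locales
     (rule companion_carrier hankel_carrier last_col_carrier hankel_sym coeff_hankel_sym hankel_inverse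
        companion_hankel last_col_cyclic | assumption)+

end

section \<open>The isomorphism\<close>

text \<open>
  The explicit map goes from the semidirect product \<open>H\<close> to the automorphism group \<open>G\<close>. Closure of \<open>H\<close>
  ensures that the inverse map sends \<open>f (x \<otimes> y)\<close> back to \<open>x \<otimes> y\<close>.
\<close>

lemma is_iso_via_inverse_bijection:
  assumes bij: "bij_betw f (carrier H) (carrier G)"
    and closed: "\<And>x y. x \<in> carrier H \<Longrightarrow> y \<in> carrier H \<Longrightarrow> x \<otimes>\<^bsub>H\<^esub> y \<in> carrier H"
    and hom: "\<And>x y. x \<in> carrier H \<Longrightarrow> y \<in> carrier H \<Longrightarrow> f (x \<otimes>\<^bsub>H\<^esub> y) = f x \<otimes>\<^bsub>G\<^esub> f y"
  shows "G \<cong> H"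
proof -
  let ?g = "inv_into (carrier H) f"
  have g: "bij_betw ?g (carrier G) (carrier H)" by (rule bij_betw_inv_into[OF bij])
  have fg: "f (?g x) = x" "?g x \<in> carrier H" if "x \<in> carrier G" for x
    using bij_betw_inv_into_right[OF bij that] bij_betwE[OF g] that by auto
  have gf: "?g (f x) = x" if "x \<in> carrier H" for x
    using bij_betw_inv_into_left[OF bij that] .
  have "?g (x \<otimes>\<^bsub>G\<^esub> y) = ?g x \<otimes>\<^bsub>H\<^esub> ?g y" if x: "x \<in> carrier G" and y: "y \<in> carrier G" for x y
    using gf[OF closed[OF fg(2)[OF x] fg(2)[OF y]]] by (simp add: hom fg x y)
  then have "?g \<in> iso G H" using g fg(2) by (auto simp: iso_def hom_def)
  then show ?thesis unfolding is_iso_def by blast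
qed

lemma matrix_algebra_simps:
  "carrier (matrix_algebra m K :: 'a::comm_ring_1 mat ring) = generated_subalgebra m (map_mat of_int K)"
  "mult (matrix_algebra m K :: 'a mat ring) = (*)"
  "add (matrix_algebra m K :: 'a mat ring) = (+)"
  "one (matrix_algebra m K :: 'a mat ring) = 1\<^sub>m m"
  "zero (matrix_algebra m K :: 'a mat ring) = 0\<^sub>m m m"
  by (simp_all add: matrix_algebra_def ring_mat_simps)

lemma SL2_V_st_V_st_mult:
  "(((a, b), (c, d)), ((v, w), (v', w'))) \<otimes>\<^bsub>SL2_V_st_V_st (matrix_algebra m K :: 'a::comm_ring_1 mat ring)\<^esub>
     (((e, f), (g, h)), ((r, s), (r', s'))) =
   (((a * e + b * g, a * f + b * h), (c * e + d * g, c * f + d * h)),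
    ((v + (a * r + b * s), w + (c * r + d * s)), (v' + (a * r' + b * s'), w' + (c * r' + d * s'))))"
  by (simp add: SL2_V_st_V_st_def semidirect_def SL2_def V_st_def V_st_act_def DirProd_def matrix_algebra_simps)

lemma GL_mult: "mult (GL n) = (*)"
  by (simp add: GL_def units_of_def ring_mat_simps)

lemma lie_aut_group_0_mult: "mult (lie_aut_group_0 m K) = (*)"
  by (simp add: lie_aut_group_0_def lie_aut_group_def GL_mult)

context cyclic_self_adjoint
begin

lemma matrix_algebra_minus:
  fixes a b :: "'a mat"
  assumes K: "A = map_mat of_int K" and a: "a \<in> Alg" and b: "b \<in> Alg"
  shows "a \<ominus>\<^bsub>matrix_algebra m K\<^esub> b = a - b"
proof -
  have "\<ominus>\<^bsub>matrix_algebra m K\<^esub> b = - b"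
    unfolding a_inv_def m_inv_def
  proof (rule the_equality)
    show "- b \<in> carrier (add_monoid (matrix_algebra m K)) \<and>
        b \<otimes>\<^bsub>add_monoid (matrix_algebra m K)\<^esub> - b = \<one>\<^bsub>add_monoid (matrix_algebra m K)\<^esub> \<and>
        - b \<otimes>\<^bsub>add_monoid (matrix_algebra m K)\<^esub> b = \<one>\<^bsub>add_monoid (matrix_algebra m K)\<^esub>"
      using b Alg_carrier[OF b] by (auto simp: matrix_algebra_simps K[symmetric] Alg_uminus intro!: eq_matI)
  next
    fix y :: "'a mat"
    assume y: "y \<in> carrier (add_monoid (matrix_algebra m K)) \<and>
        b \<otimes>\<^bsub>add_monoid (matrix_algebra m K)\<^esub> y = \<one>\<^bsub>add_monoid (matrix_algebra m K)\<^esub> \<and>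
        y \<otimes>\<^bsub>add_monoid (matrix_algebra m K)\<^esub> b = \<one>\<^bsub>add_monoid (matrix_algebra m K)\<^esub>"
    then have yA: "y \<in> Alg" and sum: "b + y = 0\<^sub>m m m" by (simp_all add: matrix_algebra_simps K[symmetric])
    show "y = - b"
    proof (rule eq_matI)
      fix i j assume "i < dim_row (- b)" "j < dim_col (- b)"
      then have ij: "i < m" "j < m" using b by simp_all
      have "(b + y) $$ (i, j) = 0" unfolding sum using ij by simp
      then show "y $$ (i, j) = (- b) $$ (i, j)"
        using ij b yA by (simp add: eq_neg_iff_add_eq_0 add.commute)
    qed (use b yA in simp_all)
  qed
  then show ?thesis
    unfolding a_minus_def using a b by (simp add: matrix_algebra_simps add_uminus_minus_mat[of _ m m])
qed

text \<open>
  The pair \<open>(h, n)\<close> stands for the product \<open>n h\<close>, and accordingly \<open>[[M, W], [0, 1]]\<close> is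
  \<open>[[1, W], [0, 1]] [[M, 0], [0, 1]]\<close>.
\<close>

fun semidirect_matrix ::
  "(('a mat \<times> 'a mat) \<times> ('a mat \<times> 'a mat)) \<times> (('a mat \<times> 'a mat) \<times> ('a mat \<times> 'a mat)) \<Rightarrow> 'a mat" where
  "semidirect_matrix (((a, b), (c, d)), ((v, w), (v', w'))) =
     four_block_mat (twisted_block a b c d) (column_block v w v' w') (0\<^sub>m 2 (2*m)) (1\<^sub>m 2)"

abbreviation "Quads \<equiv> (Alg \<times> Alg) \<times> (Alg \<times> Alg)"

text \<open>
  The product of \<open>[[M, W], [0, 1]]\<close> and \<open>[[N, V], [0, 1]]\<close> is \<open>[[M N, W + M V], [0, 1]]\<close>, and \<open>M\<close> acts on the
  columns of \<open>V\<close> as on two copies of the standard module.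
\<close>

lemma semidirect_matrix_mult:
  assumes K: "A = map_mat of_int K" and x: "x \<in> Quads \<times> Quads" and y: "y \<in> Quads \<times> Quads"
  shows "x \<otimes>\<^bsub>SL2_V_st_V_st (matrix_algebra m K)\<^esub> y \<in> Quads \<times> Quads"
    and "semidirect_matrix (x \<otimes>\<^bsub>SL2_V_st_V_st (matrix_algebra m K)\<^esub> y) = semidirect_matrix x * semidirect_matrix y"
proof -
  obtain a b c d v w v' w' where xe: "x = (((a, b), (c, d)), ((v, w), (v', w')))" by (metis surj_pair)
  obtain e f g h r s r' s' where ye: "y = (((e, f), (g, h)), ((r, s), (r', s')))" by (metis surj_pair)
  have [simp]: "a \<in> Alg" "b \<in> Alg" "c \<in> Alg" "d \<in> Alg" "v \<in> Alg" "w \<in> Alg" "v' \<in> Alg" "w' \<in> Alg"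
    using x by (simp_all add: xe)
  have [simp]: "e \<in> Alg" "f \<in> Alg" "g \<in> Alg" "h \<in> Alg" "r \<in> Alg" "s \<in> Alg" "r' \<in> Alg" "s' \<in> Alg"
    using y by (simp_all add: ye)
  note [simp] = generated_subalgebra.add generated_subalgebra.mult
  have prod: "x \<otimes>\<^bsub>SL2_V_st_V_st (matrix_algebra m K)\<^esub> y =
      (((a * e + b * g, a * f + b * h), (c * e + d * g, c * f + d * h)),
       ((v + (a * r + b * s), w + (c * r + d * s)), (v' + (a * r' + b * s'), w' + (c * r' + d * s'))))"
    unfolding xe ye by (rule SL2_V_st_V_st_mult)
  show "x \<otimes>\<^bsub>SL2_V_st_V_st (matrix_algebra m K)\<^esub> y \<in> Quads \<times> Quads"
    unfolding prod by simp
  let ?M = "twisted_block a b c d" and ?W = "column_block v w v' w'"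
  let ?N = "twisted_block e f g h" and ?V = "column_block r s r' s'"
  have M [simp]: "?M \<in> carrier_mat (2*m) (2*m)" "?N \<in> carrier_mat (2*m) (2*m)"
    and W [simp]: "?W \<in> carrier_mat (2*m) 2" "?V \<in> carrier_mat (2*m) 2" by simp_all
  have "semidirect_matrix x * semidirect_matrix y =
      four_block_mat (?M * ?N) (?M * ?V + ?W) (0\<^sub>m 2 (2*m)) (1\<^sub>m 2)"
    unfolding xe ye semidirect_matrix.simps
    by (subst mult_four_block_mat[OF M(1) W(1) zero_carrier_mat one_carrier_mat M(2) W(2) zero_carrier_mat one_carrier_mat])
       (use carrier_matD[OF M(1)] carrier_matD[OF M(2)] carrier_matD[OF W(1)] carrier_matD[OF W(2)]
          right_add_zero_mat[OF mult_carrier_mat[OF M]] right_mult_one_mat[OF W(1)] left_mult_zero_mat[OF W(2)] in simp)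
  also have "?M * ?V + ?W = ?W + ?M * ?V"
    by (rule comm_add_mat[OF mult_carrier_mat[OF M(1) W(2)] W(1)])
  finally show "semidirect_matrix (x \<otimes>\<^bsub>SL2_V_st_V_st (matrix_algebra m K)\<^esub> y) = semidirect_matrix x * semidirect_matrix y"
    unfolding prod by (simp add: twisted_block_mult twisted_block_column_block column_block_add)
qed

lemma semidirect_matrix_inj: "inj_on semidirect_matrix (Quads \<times> Quads)"
proof (rule inj_onI)
  fix x y assume x: "x \<in> Quads \<times> Quads" and y: "y \<in> Quads \<times> Quads"
    and eq: "semidirect_matrix x = semidirect_matrix y"
  obtain a b c d v w v' w' where xe: "x = (((a, b), (c, d)), ((v, w), (v', w')))" by (metis surj_pair)
  obtain e f g h r s r' s' where ye: "y = (((e, f), (g, h)), ((r, s), (r', s')))" by (metis surj_pair)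
  have [simp]: "a \<in> Alg" "b \<in> Alg" "c \<in> Alg" "d \<in> Alg" "v \<in> Alg" "w \<in> Alg" "v' \<in> Alg" "w' \<in> Alg"
    using x by (simp_all add: xe)
  have [simp]: "e \<in> Alg" "f \<in> Alg" "g \<in> Alg" "h \<in> Alg" "r \<in> Alg" "s \<in> Alg" "r' \<in> Alg" "s' \<in> Alg"
    using y by (simp_all add: ye)
  have "twisted_block a b c d = twisted_block e f g h \<and> column_block v w v' w' = column_block r s r' s'"
    using eq unfolding xe ye semidirect_matrix.simps
    by (subst (asm) four_block_mat_eq_iff[of _ "2*m" "2*m" _ 2 _ 2]) simp_all
  then show "x = y" by (simp add: xe ye twisted_block_eq_iff column_block_eq_iff)
qed

lemma SL2_V_st_V_st_carrier_iff:
  assumes K: "A = map_mat of_int K"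
  shows "(((a, b), (c, d)), ((v, w), (v', w'))) \<in> carrier (SL2_V_st_V_st (matrix_algebra m K)) \<longleftrightarrow>
    (((a, b), (c, d)), ((v, w), (v', w'))) \<in> Quads \<times> Quads \<and> a * d - b * c = 1\<^sub>m m"
proof -
  have "a * d \<ominus>\<^bsub>matrix_algebra m K\<^esub> b * c = a * d - b * c" if "a \<in> Alg" "b \<in> Alg" "c \<in> Alg" "d \<in> Alg"
    using that by (intro matrix_algebra_minus[OF K] generated_subalgebra.mult)
  then show ?thesis
    by (auto simp: SL2_V_st_V_st_def semidirect_def SL2_def V_st_def DirProd_def matrix_algebra_simps K[symmetric])
qed

lemma semidirect_matrix_in_lie_aut_group_0_iff:
  assumes K: "A = map_mat of_int K" "K \<in> carrier_mat m m" and x: "x \<in> Quads \<times> Quads"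
  shows "semidirect_matrix x \<in> carrier (lie_aut_group_0 m K) \<longleftrightarrow> x \<in> carrier (SL2_V_st_V_st (matrix_algebra m K))"
proof -
  obtain a b c d v w v' w' where xe: "x = (((a, b), (c, d)), ((v, w), (v', w')))" by (metis surj_pair)
  have [simp]: "a \<in> Alg" "b \<in> Alg" "c \<in> Alg" "d \<in> Alg" "v \<in> Alg" "w \<in> Alg" "v' \<in> Alg" "w' \<in> Alg"
    using x by (simp_all add: xe)
  let ?M = "twisted_block a b c d" and ?W = "column_block v w v' w'"
  let ?iso = "\<lambda>M :: 'a mat. M \<in> carrier (GL (2*m)) \<and>
    M * skew_block (1\<^sub>m m) * M\<^sup>T = skew_block (1\<^sub>m m) \<and> M * skew_block A * M\<^sup>T = skew_block A"
  have "semidirect_matrix x \<in> carrier (lie_aut_group_0 m K) \<longleftrightarrow> ?iso ?M"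
  proof
    assume "semidirect_matrix x \<in> carrier (lie_aut_group_0 m K)"
    then obtain M W where *: "semidirect_matrix x = four_block_mat M W (0\<^sub>m 2 (2*m)) (1\<^sub>m 2)"
      "W \<in> carrier_mat (2*m) 2" "?iso M" unfolding lie_aut_group_0_iff[OF K(2)] K(1) by blast
    then have M: "M \<in> carrier_mat (2*m) (2*m)" by (simp add: GL_carrier_iff)
    have "?M = M" using *(1) unfolding xe semidirect_matrix.simps
      by (subst (asm) four_block_mat_eq_iff[of _ "2*m" "2*m" _ 2 _ 2]) (use * M in simp_all)
    with *(3) show "?iso ?M" by simp
  next
    assume "?iso ?M"
    moreover have "?W \<in> carrier_mat (2*m) 2" by simp
    ultimately show "semidirect_matrix x \<in> carrier (lie_aut_group_0 m K)"
      unfolding lie_aut_group_0_iff[OF K(2)] xe semidirect_matrix.simps K(1)[symmetric] by blast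
  qed
  also have "\<dots> \<longleftrightarrow> a * d - b * c = 1\<^sub>m m"
    unfolding isometries_eq_twisted_blocks by (auto simp: twisted_block_eq_iff)
  also have "\<dots> \<longleftrightarrow> x \<in> carrier (SL2_V_st_V_st (matrix_algebra m K))"
    unfolding xe SL2_V_st_V_st_carrier_iff[OF K(1)] by simp
  finally show ?thesis .
qed

lemma semidirect_matrix_surj:
  assumes K: "A = map_mat of_int K" "K \<in> carrier_mat m m" and g: "g \<in> carrier (lie_aut_group_0 m K)"
  shows "\<exists>x\<in>Quads \<times> Quads. g = semidirect_matrix x"
proof -
  obtain M W where gb: "g = four_block_mat M W (0\<^sub>m 2 (2*m)) (1\<^sub>m 2)" and W: "W \<in> carrier_mat (2*m) 2"
    and iso: "M \<in> carrier (GL (2*m)) \<and> M * skew_block (1\<^sub>m m) * M\<^sup>T = skew_block (1\<^sub>m m) \<and> M * skew_block A * M\<^sup>T = skew_block A"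
    using g unfolding lie_aut_group_0_iff[OF K(2)] K(1) by blast
  obtain a b c d where q: "a \<in> Alg" "b \<in> Alg" "c \<in> Alg" "d \<in> Alg" "M = twisted_block a b c d"
    using iso unfolding isometries_eq_twisted_blocks by blast
  obtain v w v' w' where u: "v \<in> Alg" "w \<in> Alg" "v' \<in> Alg" "w' \<in> Alg" "W = column_block v w v' w'"
    using column_block_surj[OF W] by blast
  show ?thesis
    using q u by (intro bexI[of _ "(((a, b), (c, d)), ((v, w), (v', w')))"]) (simp_all add: gb)
qed

text \<open>
  The determinant equation says that the matrix is an isometry, and isometries compose.
\<close>

lemma det_mult:
  assumes [simp]: "a \<in> Alg" "b \<in> Alg" "c \<in> Alg" "d \<in> Alg" "e \<in> Alg" "f \<in> Alg" "g \<in> Alg" "h \<in> Alg"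
    and det: "a * d - b * c = 1\<^sub>m m" "e * h - f * g = 1\<^sub>m m"
  shows "(a * e + b * g) * (c * f + d * h) - (a * f + b * h) * (c * e + d * g) = 1\<^sub>m m"
proof -
  let ?M = "twisted_block a b c d" and ?N = "twisted_block e f g h" and ?J = "skew_block (1\<^sub>m m) :: 'a mat"
  have M: "?M \<in> carrier_mat (2*m) (2*m)" "?N \<in> carrier_mat (2*m) (2*m)" and J: "?J \<in> carrier_mat (2*m) (2*m)"
    by simp_all
  note [simp] = M J generated_subalgebra.add generated_subalgebra.mult
  note assoc2 = assoc_mult_mat[of _ "2*m" "2*m" _ "2*m" _ "2*m"] and carrier2 = mult_carrier_mat[of _ "2*m" "2*m" _ "2*m"]
  have iso: "?M * ?J * ?M\<^sup>T = ?J" "?N * ?J * ?N\<^sup>T = ?J"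
    using det by (simp_all add: twisted_block_preserves_form_iff)
  have "(?M * ?N) * ?J * (?M * ?N)\<^sup>T = ?M * (?N * ?J * ?N\<^sup>T) * ?M\<^sup>T"
    by (simp add: transpose_mult[OF M] assoc2 carrier2)
  then have "(?M * ?N) * ?J * (?M * ?N)\<^sup>T = ?J" by (simp only: iso)
  then show ?thesis
    unfolding twisted_block_mult[OF assms(1-8)] by (subst (asm) twisted_block_preserves_form_iff) simp_all
qed

theorem lie_aut_group_0_iso:
  assumes K: "A = map_mat of_int K" "K \<in> carrier_mat m m"
  shows "(lie_aut_group_0 m K :: 'a mat monoid) \<cong> SL2_V_st_V_st (matrix_algebra m K :: 'a mat ring)"
    (is "?G \<cong> ?H")
proof (rule is_iso_via_inverse_bijection)
  have sub: "x \<in> Quads \<times> Quads" if "x \<in> carrier ?H" for x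
  proof -
    obtain a b c d v w v' w' where xe: "x = (((a, b), (c, d)), ((v, w), (v', w')))" by (metis surj_pair)
    show ?thesis using that unfolding xe SL2_V_st_V_st_carrier_iff[OF K(1)] by blast
  qed
  show "bij_betw semidirect_matrix (carrier ?H) (carrier ?G)"
    unfolding bij_betw_def
  proof (intro conjI equalityI subsetI)
    show "inj_on semidirect_matrix (carrier ?H)" using semidirect_matrix_inj sub by (meson inj_on_subset subsetI)
  next
    fix g assume "g \<in> semidirect_matrix ` carrier ?H"
    then show "g \<in> carrier ?G" using semidirect_matrix_in_lie_aut_group_0_iff[OF K] sub by blast
  next
    fix g assume g: "g \<in> carrier ?G"
    obtain x where x: "x \<in> Quads \<times> Quads" "g = semidirect_matrix x"
      using semidirect_matrix_surj[OF K g] by (elim bexE)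
    have "x \<in> carrier ?H" using g unfolding x(2) semidirect_matrix_in_lie_aut_group_0_iff[OF K x(1)] .
    then show "g \<in> semidirect_matrix ` carrier ?H" unfolding x(2) by (rule imageI)
  qed
  fix x y assume x: "x \<in> carrier ?H" and y: "y \<in> carrier ?H"
  show "semidirect_matrix (x \<otimes>\<^bsub>?H\<^esub> y) = semidirect_matrix x \<otimes>\<^bsub>?G\<^esub> semidirect_matrix y"
    unfolding lie_aut_group_0_mult by (rule semidirect_matrix_mult(2)[OF K(1) sub[OF x] sub[OF y]])
  show "x \<otimes>\<^bsub>?H\<^esub> y \<in> carrier ?H"
  proof -
    obtain a b c d v w v' w' where xe: "x = (((a, b), (c, d)), ((v, w), (v', w')))" by (metis surj_pair)
    obtain e f g h r s r' s' where ye: "y = (((e, f), (g, h)), ((r, s), (r', s')))" by (metis surj_pair)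
    have "a \<in> Alg" "b \<in> Alg" "c \<in> Alg" "d \<in> Alg" "e \<in> Alg" "f \<in> Alg" "g \<in> Alg" "h \<in> Alg"
      "a * d - b * c = 1\<^sub>m m" "e * h - f * g = 1\<^sub>m m"
      using x y unfolding xe ye SL2_V_st_V_st_carrier_iff[OF K(1)] by simp_all
    note det = det_mult[OF this]
    have "x \<otimes>\<^bsub>?H\<^esub> y =
      (((a * e + b * g, a * f + b * h), (c * e + d * g, c * f + d * h)),
       ((v + (a * r + b * s), w + (c * r + d * s)), (v' + (a * r' + b * s'), w' + (c * r' + d * s'))))"
      unfolding xe ye by (rule SL2_V_st_V_st_mult)
    with semidirect_matrix_mult(1)[OF K(1) sub[OF x] sub[OF y]] det show ?thesis
      by (simp only: SL2_V_st_V_st_carrier_iff[OF K(1)] simp_thms)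
  qed
qed

end

theorem theorem2p3:
  fixes m :: nat and p :: "int poly" and K :: "int mat"
  assumes "m \<ge> 1"
    and "degree p = m" and "lead_coeff p = 1"
    and "K = companion_mat p"
  shows "(lie_aut_group_0 m K :: 'k::{idom, ring_char_0} mat monoid)
           \<cong> SL2_V_st_V_st (matrix_algebra m K :: 'k mat ring)"
proof -
  have "K \<in> carrier_mat m m" using assms(2) by (simp add: assms(4) companion_mat_def)
  with companion_cyclic_self_adjoint[OF assms(1-3)] show ?thesis
    unfolding assms(4)[symmetric] by (rule cyclic_self_adjoint.lie_aut_group_0_iso[OF _ refl])
qed

end
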